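(* Let $\theta=\cot^{-1}\sqrt{7}$. For every integer $k\ge 1$, $$\zeta(4k+1)=(2\pi)^{4k+1}\sum_{j=0}^k \frac{(-1)^{j}\, c_{jk}\, B_{2j}\, B_{4k+2-2j}}{(2j)!\,(4k+2-2j)!}+a_k\,\mathcal{L}_{e^{-\sqrt{7}\pi}}(-4k-1)+b_k\,\mathcal{L}_{e^{-2\sqrt{7}\pi}}(-4k-1)+2^{-4k}a_k\,\mathcal{L}_{e^{-4\sqrt{7}\pi}}(-4k-1),$$ where $$a_k=\frac{2+2^{-4k}-2^{-2k+1}\cos(4k\theta)}{1-2^{-2k}\cos(4k\theta)},$$ $$b_k=-\frac{4+3\times2^{-4k}+2^{-8k}-2^{-2k+2}\cos(4k\theta)-2^{-6k+1}\cos(4k\theta)}{1-2^{-2k}\cos(4k\theta)},$$ $$c_{jk}=\frac{2^{2k+\frac12-j}\cos[(2j-1)\theta]-2^{j-\frac12}\cos[(4k+1-2j)\theta]}{2^{2k}-\cos(4k\theta)}.$$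
   Context: For complex $q$ with $|q|<1$ and $s\in\mathbb{C}$, the Lambert series is $\mathcal{L}_q(s)=\sum_{n=1}^\infty \frac{n^s q^n}{1-q^n}$. $\zeta$ is the Riemann zeta function and $B_m$ is the $m$th Bernoulli number. $\cot^{-1}\sqrt{7}$ denotes the angle in $(0,\pi/2)$ whose cotangent is $\sqrt{7}$. *)

theory Defs
  imports "HOL-Analysis.Analysis" "HOL-Computational_Algebra.Computational_Algebra"
begin

text \<open>The Riemann zeta function on the half-plane \<open>Re s > 1\<close>, where it is given by its Dirichlet
  series; no value outside this half-plane is ever used.\<close>

definition zeta :: "complex \<Rightarrow> complex" where
  "zeta s = (\<Sum>n. 1 / of_nat (Suc n) powr s)"

text \<open>The exponential generating function of the Bernoulli numbers is \<open>x / (exp x - 1)\<close>,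
  so \<open>B\<^sub>1 = - 1/2\<close>.\<close>

definition bernoulli :: "nat \<Rightarrow> real" where
  "bernoulli n = fact n * fps_nth (fps_X / (fps_exp 1 - 1)) n"

text \<open>The Lambert series \<open>\<L>\<^sub>q(s)\<close>, meaningful for \<open>norm q < 1\<close>.
  The summation index is shifted: term \<open>n\<close> below is term \<open>n + 1\<close> of the usual series.\<close>

definition lambert_series :: "complex \<Rightarrow> complex \<Rightarrow> complex" where
  "lambert_series q s = (\<Sum>n. of_nat (Suc n) powr s * q ^ Suc n / (1 - q ^ Suc n))"

definition coeff_a :: "real \<Rightarrow> nat \<Rightarrow> real" where
  "coeff_a \<theta> k =
     (2 + 2 powr (- 4 * real k) - 2 powr (- 2 * real k + 1) * cos (4 * real k * \<theta>))
     / (1 - 2 powr (- 2 * real k) * cos (4 * real k * \<theta>))"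

definition coeff_b :: "real \<Rightarrow> nat \<Rightarrow> real" where
  "coeff_b \<theta> k =
     - ((4 + 3 * 2 powr (- 4 * real k) + 2 powr (- 8 * real k)
         - 2 powr (- 2 * real k + 2) * cos (4 * real k * \<theta>)
         - 2 powr (- 6 * real k + 1) * cos (4 * real k * \<theta>))
        / (1 - 2 powr (- 2 * real k) * cos (4 * real k * \<theta>)))"

definition coeff_c :: "real \<Rightarrow> nat \<Rightarrow> nat \<Rightarrow> real" where
  "coeff_c \<theta> j k =
     (2 powr (2 * real k + 1 / 2 - real j) * cos ((2 * real j - 1) * \<theta>)
      - 2 powr (real j - 1 / 2) * cos ((4 * real k + 1 - 2 * real j) * \<theta>))
     / (2 powr (2 * real k) - cos (4 * real k * \<theta>))"

end

(*
  Write F(t) for the Lambert series at q = exp(2 pi i t), s = 4k+1 and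
  H(t) = F(t) + zeta(s)/2. Then H(t) = (i/2) sum_n cot(pi n t) / n^s. Expanding the
  cotangents in partial fractions turns this into a double series over (n, m), and
  exchanging n and m expresses H(t) - t^(4k) H(-1/t) as a finite sum of products of
  even zeta values, i.e. of Bernoulli numbers (Ramanujan's formula, here for complex t).

  The Hecke operator at 2 gives L(r) + L(-r) = (2 + 2^(1-s)) L(r^2) - 2^(1-s) L(r^4).
  Let t = (1 + i sqrt 7)/2 = sqrt 2 exp(i (pi/2 - theta)), a point with complex
  multiplication: -1/t = (t-1)/2 is conjugate under t -> -cnj t to t/2. With
  r = exp(i pi t) the Hecke relation therefore reads
  2 Re F(-1/t) = (2 + 2^(1-s)) F(t) - 2^(1-s) F(2t), so that eliminating F(-1/t) by the
  inversion formula leaves an equation for zeta(s), F(t) and F(2t). A second Hecke relation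
  at r = exp(-pi sqrt 7) replaces F(t), where q = -exp(-pi sqrt 7), by the three series of
  the theorem.
*)

theory Submission
  imports Defs
begin

section \<open>The cotangent and even zeta values\<close>

text \<open>This is the logarithmic derivative of the reflection formula for Gamma: both sides are
  differentiated at z, and the common factor pi / sin (pi z), nonzero off the integers, is
  cancelled.\<close>

lemma Digamma_reflection:
  fixes z :: complex
  assumes "z \<notin> \<int>"
  shows "of_real pi * cot (of_real pi * z) = Digamma (1 - z) - Digamma z"
proof -
  have z: "z \<notin> \<int>\<^sub>\<le>\<^sub>0" "1 - z \<notin> \<int>\<^sub>\<le>\<^sub>0"
    using assms nonpos_Ints_subset_Ints[where 'a=complex] Ints_diff[of 1 "1 - z"] by auto
  have sin: "sin (of_real pi * z) \<noteq> 0"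
    using assms by (auto simp: sin_eq_0)
  have eq: "Gamma w * Gamma (1 - w) = of_real pi / sin (of_real pi * w)" for w :: complex
    by (rule Gamma_reflection_complex)
  have "((\<lambda>w. Gamma w * Gamma (1 - w)) has_field_derivative
          Gamma z * Gamma (1 - z) * (Digamma z - Digamma (1 - z))) (at z)"
    by (rule derivative_eq_intros refl | use z in \<open>simp add: algebra_simps\<close>)+
  moreover have "((\<lambda>w. Gamma w * Gamma (1 - w)) has_field_derivative
          - (of_real pi / sin (of_real pi * z)) * (of_real pi * cot (of_real pi * z))) (at z)"
    unfolding eq
    by (rule derivative_eq_intros refl | use sin in \<open>simp add: cot_def field_simps power2_eq_square\<close>)+
  ultimately have "of_real pi / sin (of_real pi * z) * (Digamma z - Digamma (1 - z)) = - (of_real pi / sin (of_real pi * z)) * (of_real pi * cot (of_real pi * z))"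
    unfolding eq by (rule DERIV_unique)
  then have "of_real pi / sin (of_real pi * z) * (Digamma z - Digamma (1 - z) + of_real pi * cot (of_real pi * z)) = 0"
    by (simp add: algebra_simps)
  with sin have "Digamma z - Digamma (1 - z) + of_real pi * cot (of_real pi * z) = 0"
    by simp
  then show ?thesis
    by (simp add: algebra_simps add_eq_0_iff2)
qed

text \<open>Subtracting the Digamma series at 1 + z from the one at 1 - z cancels the harmonic
  parts. \<open>Digamma_reflection\<close> evaluates the difference, and shifting Digamma from z to
  1 + z produces the term -1/z.\<close>

lemma cot_partial_fractions:
  fixes z :: complex
  assumes z: "z \<notin> \<int>"
  shows "(\<lambda>m. 2 * z / (z\<^sup>2 - of_nat (Suc m) ^ 2)) sums (of_real pi * cot (of_real pi * z) - 1 / z)"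
proof -
  have nz: "1 + z \<notin> \<int>\<^sub>\<le>\<^sub>0" "1 - z \<notin> \<int>\<^sub>\<le>\<^sub>0" "z \<noteq> 0"
    using assms nonpos_Ints_subset_Ints[where 'a=complex] Ints_diff[of 1 "1 - z"] Ints_diff[of "1 + z" 1] by auto
  have D: "(\<lambda>n. inverse (of_nat (Suc n)) - inverse (w + of_nat n)) sums (Digamma w + euler_mascheroni)"
    if "w \<notin> \<int>\<^sub>\<le>\<^sub>0" for w :: complex
  proof -
    from that have "w \<noteq> 0" by auto
    from summable_sums[OF summable_Digamma[OF this]] show ?thesis
      by (simp add: Digamma_def)
  qed
  have "(\<lambda>n. (inverse (of_nat (Suc n)) - inverse ((1 - z) + of_nat n))
            - (inverse (of_nat (Suc n)) - inverse ((1 + z) + of_nat n)))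
         sums (Digamma (1 - z) + euler_mascheroni - (Digamma (1 + z) + euler_mascheroni))"
    by (intro sums_diff D nz)
  also have "Digamma (1 - z) + euler_mascheroni - (Digamma (1 + z) + euler_mascheroni)
           = of_real pi * cot (of_real pi * z) - 1 / z"
    using Digamma_reflection[OF z] Digamma_plus1[OF nz(3)] by (simp add: add.commute)
  also have "(\<lambda>n. (inverse (of_nat (Suc n)) - inverse ((1 - z) + of_nat n))
            - (inverse (of_nat (Suc n)) - inverse ((1 + z) + of_nat n)))
      = (\<lambda>m. 2 * z / (z\<^sup>2 - of_nat (Suc m) ^ 2))"
  proof
    fix n
    have a: "z + of_nat (Suc n) \<noteq> 0" and b: "z - of_nat (Suc n) \<noteq> 0"
      using z Ints_of_nat[of "Suc n"] by (auto simp: add_eq_0_iff2 simp del: of_nat_Suc)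
    have c: "z\<^sup>2 - of_nat (Suc n) ^ 2 = (z + of_nat (Suc n)) * (z - of_nat (Suc n))"
      by (simp add: power2_eq_square algebra_simps)
    have "1 - z + of_nat n = - (z - of_nat (Suc n))"
      by simp
    then have "inverse (1 - z + of_nat n) = - (1 / (z - of_nat (Suc n)))"
      by (metis inverse_eq_divide inverse_minus_eq)
    moreover have "inverse (1 + z + of_nat n) = 1 / (z + of_nat (Suc n))"
      by (simp add: field_simps)
    moreover have "1 / (z - of_nat (Suc n)) + 1 / (z + of_nat (Suc n)) = 2 * z / (z\<^sup>2 - of_nat (Suc n) ^ 2)"
      unfolding c using a b by (simp add: field_simps del: of_nat_Suc)
    ultimately show "(inverse (of_nat (Suc n)) - inverse ((1 - z) + of_nat n))
            - (inverse (of_nat (Suc n)) - inverse ((1 + z) + of_nat n)) = 2 * z / (z\<^sup>2 - of_nat (Suc n) ^ 2)"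
      by simp
  qed
  finally show ?thesis .
qed

text \<open>The value zeta(2j) for j >= 1, with natural powers instead of \<open>powr\<close>. At j
  = 0 the series diverges and the value carries no meaning.\<close>

definition zeta_even :: "nat \<Rightarrow> complex" where
  "zeta_even j = (\<Sum>n. 1 / of_nat (Suc n) ^ (2 * j))"

lemma summable_inverse_Suc_power:
  assumes "s \<ge> 2"
  shows "summable (\<lambda>n. 1 / of_nat (Suc n) ^ s :: 'a :: {real_normed_field, banach})"
proof -
  have "summable (\<lambda>n. inverse (of_nat (Suc n) ^ s) :: 'a)"
    using inverse_power_summable[OF assms] summable_Suc_iff[of "\<lambda>n. inverse (of_nat n ^ s) :: 'a"] by simp
  then show ?thesis by (simp add: inverse_eq_divide)
qed

lemma has_sum_inverse_Suc_power:
  assumes "s \<ge> 2"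
  shows "((\<lambda>n. 1 / of_nat (Suc n) ^ s :: complex) has_sum (\<Sum>n. 1 / of_nat (Suc n) ^ s)) UNIV"
proof (rule norm_summable_imp_has_sum)
  show "summable (\<lambda>n. norm (1 / of_nat (Suc n) ^ s :: complex))"
    using summable_inverse_Suc_power[OF assms, where 'a=real]
    by (simp add: norm_divide norm_power del: of_nat_Suc)
  show "(\<lambda>n. 1 / of_nat (Suc n) ^ s :: complex) sums (\<Sum>n. 1 / of_nat (Suc n) ^ s)"
    by (intro summable_sums summable_inverse_Suc_power assms)
qed

text \<open>The basis of every interchange of sums below: each double series is dominated by a
  product of two convergent ones. For complex families \<open>summable_on\<close> is already
  absolute, so norms may be taken freely.\<close>

lemma summable_on_product_bound:
  fixes f :: "'a \<Rightarrow> complex" and g :: "'b \<Rightarrow> complex" and h :: "'a \<times> 'b \<Rightarrow> complex"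
  assumes "f summable_on A" "g summable_on B"
    and "\<And>x y. x \<in> A \<Longrightarrow> y \<in> B \<Longrightarrow> norm (h (x, y)) \<le> norm (f x) * norm (g y)"
  shows "h summable_on A \<times> B"
proof (rule abs_summable_summable, rule Infinite_Sum.abs_summable_on_comparison_test)
  show "(\<lambda>p. norm ((\<lambda>(x, y). f x * g y) p)) summable_on A \<times> B"
  proof (rule summable_on_SigmaI)
    have g: "((\<lambda>y. norm (g y)) has_sum (\<Sum>\<^sub>\<infinity>y\<in>B. norm (g y))) B"
      using assms(2) by (intro has_sum_infsum) (simp flip: summable_on_iff_abs_summable_on_complex)
    show "((\<lambda>y. norm ((\<lambda>(x, y). f x * g y) (x, y))) has_sum (norm (f x) * (\<Sum>\<^sub>\<infinity>y\<in>B. norm (g y)))) B" for x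
      using has_sum_cmult_right[OF g] by (simp add: norm_mult)
    show "(\<lambda>x. norm (f x) * (\<Sum>\<^sub>\<infinity>y\<in>B. norm (g y))) summable_on A"
      using assms(1) by (intro summable_on_cmult_left) (simp flip: summable_on_iff_abs_summable_on_complex)
  qed auto
  show "norm (h p) \<le> norm ((\<lambda>(x, y). f x * g y) p)" if "p \<in> A \<times> B" for p
    using assms(3) that by (auto simp: norm_mult)
qed

text \<open>A geometric series in x = z^2 / M^2 with M = m + 1, which converges because M >= 1 >
  norm z.\<close>

lemma geometric_partial_fraction:
  fixes z :: complex
  assumes "norm z < 1"
  shows "((\<lambda>j. z ^ (2 * j + 2) * (1 / of_nat (Suc m) ^ (2 * j + 2))) has_sum
           - (z\<^sup>2 / (z\<^sup>2 - of_nat (Suc m) ^ 2))) UNIV"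
proof -
  define M :: complex where "M = of_nat (Suc m)"
  have M: "norm M \<ge> 1" unfolding M_def by (simp del: of_nat_Suc)
  define x where "x = z\<^sup>2 / M\<^sup>2"
  have M0: "M \<noteq> 0" using M by auto
  have "norm z < norm M" using assms M by linarith
  then have x: "norm x < 1"
    using M by (simp add: x_def norm_divide norm_power power_strict_mono divide_less_eq)
  have "x \<noteq> 1" using x by auto
  then have ne: "z\<^sup>2 \<noteq> M\<^sup>2" using M0 by (auto simp: x_def)
  have "(\<lambda>j. x * x ^ j) sums (x * (1 / (1 - x)))"
    by (intro sums_mult geometric_sums x)
  moreover have "summable (\<lambda>j. norm (x * x ^ j))"
    using x by (simp add: norm_mult norm_power)
  ultimately have "((\<lambda>j. x * x ^ j) has_sum (x * (1 / (1 - x)))) UNIV"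
    by (intro norm_summable_imp_has_sum)
  also have "x * (1 / (1 - x)) = - (z\<^sup>2 / (z\<^sup>2 - M\<^sup>2))"
    using M0 ne \<open>x \<noteq> 1\<close> by (simp add: x_def divide_simps) (auto simp: algebra_simps)
  also have "(\<lambda>j. x * x ^ j) = (\<lambda>j. z ^ (2 * j + 2) * (1 / M ^ (2 * j + 2)))"
    by (simp add: x_def power_divide power_mult power_add power_mult_distrib power2_eq_square fun_eq_iff mult_ac)
  finally show ?thesis unfolding M_def .
qed

text \<open>Each partial fraction is expanded geometrically. Summing over m first then collects
  zeta(2j + 2) as the coefficient of z^(2j + 2).\<close>

lemma cot_power_series:
  fixes z :: complex
  assumes z: "z \<notin> \<int>" "norm z < 1"
  shows "(\<lambda>j. - 2 * zeta_even (j + 1) * z ^ (2 * j + 2)) sums (of_real pi * z * cot (of_real pi * z) - 1)"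
proof -
  let ?f = "\<lambda>(m, j). z ^ (2 * j + 2) * (1 / of_nat (Suc m) ^ (2 * j + 2))"
  have "?f summable_on UNIV \<times> UNIV"
  proof (rule summable_on_product_bound)
    show "(\<lambda>m. 1 / of_nat (Suc m) ^ 2 :: complex) summable_on UNIV"
      using has_sum_inverse_Suc_power[of 2] by (auto simp: has_sum_imp_summable)
    have "((\<lambda>j. z ^ j) has_sum (1 / (1 - z))) UNIV"
      using z by (intro norm_summable_imp_has_sum geometric_sums) (auto simp: norm_power)
    then show "(\<lambda>j. z ^ j) summable_on UNIV"
      by (rule has_sum_imp_summable)
    fix m j :: nat
    \<comment> \<open>Lowering the exponent of \<open>Suc m\<close> to 2 decouples m from j; the
      power of z is lowered to meet a plain geometric series.\<close>
    have "norm z ^ (2 * j + 2) \<le> norm z ^ j"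
      using z by (intro power_decreasing) auto
    moreover have "1 / real (Suc m) ^ (2 * j + 2) \<le> 1 / real (Suc m) ^ 2"
      by (intro divide_left_mono power_increasing) (auto simp del: of_nat_Suc)
    ultimately have "norm z ^ (2 * j + 2) * (1 / real (Suc m) ^ (2 * j + 2)) \<le> norm z ^ j * (1 / real (Suc m) ^ 2)"
      by (intro mult_mono) auto
    then show "norm (?f (m, j)) \<le> norm (1 / of_nat (Suc m) ^ 2 :: complex) * norm (z ^ j)"
      by (simp add: norm_mult norm_divide norm_power mult.commute del: of_nat_Suc)
  qed
  then obtain S where S: "(?f has_sum S) (UNIV \<times> UNIV)"
    by (auto simp: summable_on_def)
  have "((\<lambda>m. - (z\<^sup>2 / (z\<^sup>2 - of_nat (Suc m) ^ 2))) has_sum S) UNIV"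
    by (rule has_sum_SigmaD[OF S]) (use geometric_partial_fraction[OF z(2)] in simp)
  then have "(\<lambda>m. - (z\<^sup>2 / (z\<^sup>2 - of_nat (Suc m) ^ 2))) sums S"
    by (rule has_sum_imp_sums)
  from sums_mult[OF this, of "-2"]
  have A: "(\<lambda>m. z * (2 * z / (z\<^sup>2 - of_nat (Suc m) ^ 2))) sums (- 2 * S)"
    by (simp add: power2_eq_square mult_ac del: of_nat_Suc)
  have "((\<lambda>(j, m). ?f (m, j)) has_sum S) (UNIV \<times> UNIV)"
    using S by (subst has_sum_swap) simp
  then have "((\<lambda>j. z ^ (2 * j + 2) * zeta_even (j + 1)) has_sum S) UNIV"
  proof (rule has_sum_SigmaD)
    fix j
    show "((\<lambda>m. case (j, m) of (j, m) \<Rightarrow> ?f (m, j)) has_sum z ^ (2 * j + 2) * zeta_even (j + 1)) UNIV"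
      using has_sum_cmult_right[OF has_sum_inverse_Suc_power[of "2 * j + 2"]]
      by (simp add: zeta_even_def del: of_nat_Suc)
  qed
  from has_sum_imp_sums[OF this, THEN sums_mult, of "-2"]
  have B: "(\<lambda>j. - 2 * zeta_even (j + 1) * z ^ (2 * j + 2)) sums (- 2 * S)"
    by (simp add: mult_ac)
  have "z \<noteq> 0" using z by auto
  have "- 2 * S = z * (of_real pi * cot (of_real pi * z) - 1 / z)"
    using A sums_mult[OF cot_partial_fractions[OF z(1)], of z] by (rule sums_unique2)
  also have "\<dots> = of_real pi * z * cot (of_real pi * z) - 1"
    using \<open>z \<noteq> 0\<close> by (simp add: algebra_simps)
  finally show ?thesis using B by simp
qed

text \<open>It serves twice: at w / (2i) it leads to the Bernoulli generating function, and in the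
  Lambert series exp (2 i z) is a power of q. The hypothesis excludes the poles.\<close>

lemma cot_conv_exp:
  fixes z :: complex
  assumes "exp (2 * \<i> * z) \<noteq> 1"
  shows "cot z = \<i> * (1 + 2 / (exp (2 * \<i> * z) - 1))"
proof -
  define E where "E = exp (\<i> * z)"
  have E: "E \<noteq> 0" "exp (- (\<i> * z)) = 1 / E" "exp (2 * \<i> * z) = E\<^sup>2"
    by (auto simp: E_def exp_minus field_simps exp_double power2_eq_square simp flip: exp_add)
  have c: "cos z = (E + 1 / E) / 2" "sin z = (E - 1 / E) / (2 * \<i>)"
    using E(2) by (auto simp: cos_exp_eq sin_exp_eq E_def)
  have "E\<^sup>2 - 1 \<noteq> 0" using assms E by auto
  moreover from this have "E - 1 / E \<noteq> 0" using E(1) by (auto simp: field_simps power2_eq_square)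
  ultimately show ?thesis
    unfolding cot_def c E(3) using E(1)
    by (simp add: divide_simps) (auto simp: algebra_simps power2_eq_square)
qed

section \<open>Bernoulli numbers and Euler's formula for zeta(2j)\<close>

lemma fps_exp_minus_1_nonzero: "fps_exp 1 - 1 \<noteq> (0 :: 'a :: field_char_0 fps)"
proof
  assume "fps_exp 1 - 1 = (0 :: 'a fps)"
  then have "(fps_exp 1 - 1 :: 'a fps) $ 1 = 0" by simp
  then show False by simp
qed

text \<open>The quotient in the definition of \<open>bernoulli\<close> is exact, since
  \<open>fps_X\<close> and \<open>fps_exp 1 - 1\<close> both have subdegree 1. The multiplied-out
  identity is then carried from real to complex coefficients.\<close>

lemma bernoulli_fps_complex:
  "Abs_fps (\<lambda>n. complex_of_real (bernoulli n / fact n)) * (fps_exp 1 - 1) = fps_X"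
proof -
  let ?R = "fps_X / (fps_exp 1 - 1) :: real fps"
  have "subdegree (fps_exp 1 - 1 :: real fps) \<le> subdegree (fps_X :: real fps)"
    by (auto intro!: subdegree_leI)
  then have "fps_exp 1 - 1 dvd (fps_X :: real fps)"
    by (subst fps_dvd_iff) (auto simp: fps_exp_minus_1_nonzero)
  then have R: "?R * (fps_exp 1 - 1) = fps_X"
    by (rule dvd_div_mult_self)
  show ?thesis
  proof (rule fps_ext)
    fix n
    have "(Abs_fps (\<lambda>n. complex_of_real (bernoulli n / fact n)) * (fps_exp 1 - 1)) $ n
        = of_real ((?R * (fps_exp 1 - 1)) $ n)"
      unfolding fps_mult_nth of_real_sum
      by (intro sum.cong) (auto simp: bernoulli_def)
    then show "(Abs_fps (\<lambda>n. complex_of_real (bernoulli n / fact n)) * (fps_exp 1 - 1)) $ n = (fps_X :: complex fps) $ n"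
      unfolding R by simp
  qed
qed

text \<open>The other solutions of exp w = 1 have norm at least 2 pi. Hence exp w - 1 vanishes in
  the unit disc only at the origin.\<close>

lemma exp_eq_1_imp_zero:
  fixes w :: complex
  assumes "exp w = 1" "norm w < 1"
  shows "w = 0"
proof -
  from assms obtain n :: int where n: "Re w = 0" "Im w = of_int (2 * n) * pi"
    by (auto simp: exp_eq_1)
  have "\<bar>Im w\<bar> = 2 * pi * \<bar>of_int n\<bar>"
    unfolding n by (simp add: abs_mult)
  then have *: "2 * pi * \<bar>of_int n\<bar> < 1"
    using assms abs_Im_le_cmod[of w] by linarith
  have "n = 0"
  proof (rule ccontr)
    assume "n \<noteq> 0"
    then have "1 \<le> \<bar>real_of_int n\<bar>" by linarith
    then have "2 * pi * 1 \<le> 2 * pi * \<bar>of_int n\<bar>" by (intro mult_left_mono) auto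
    with * pi_gt3 show False by linarith
  qed
  with n show ?thesis by (simp add: complex_eq_iff)
qed

text \<open>With z = w / (2 pi i) one has pi z cot (pi z) = w/2 + w / (exp w - 1), so
  \<open>cot_power_series\<close> yields the coefficients. The summand w/2 accounts for the -1/2 in
  degree 1.\<close>

lemma zeta_even_fps_expansion:
  defines "F \<equiv> Abs_fps (\<lambda>n. if n = 0 then 1 else if n = 1 then - 1 / 2
                 else if even n then - 2 * zeta_even (n div 2) / (2 * of_real pi * \<i>) ^ n else 0)"
  shows "(\<lambda>w. if w = 0 then 1 else w / (exp w - 1)) has_fps_expansion F"
proof (rule has_fps_expansionI)
  have "eventually (\<lambda>w. w \<in> ball (0::complex) 1) (nhds 0)"
    by (intro eventually_nhds_in_open) auto
  then show "\<forall>\<^sub>F w in nhds 0. (\<lambda>n. F $ n * w ^ n) sums (if w = 0 then 1 else w / (exp w - 1))"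
  proof eventually_elim
    case (elim w)
    then have w: "norm w < 1" by simp
    show ?case
    proof (cases "w = 0")
      case True
      then show ?thesis using powser_sums_zero[of "fps_nth F"] by (simp add: F_def)
    next
      case False
      define z where "z = w / (2 * of_real pi * \<i>)"
      have zw: "2 * \<i> * (of_real pi * z) = w"
        by (simp add: z_def)
      have nz: "norm z < 1"
        using w pi_gt3 by (simp add: z_def norm_divide norm_mult divide_less_eq)
      have "z \<notin> \<int>"
      proof
        assume "z \<in> \<int>"
        then obtain n where n: "z = of_int n" by (auto elim: Ints_cases)
        with nz have "n = 0" by simp
        with n False show False by (simp add: z_def)
      qed
      have e: "exp w \<noteq> 1"
        using exp_eq_1_imp_zero[OF _ w] False by blast
      have "of_real pi * z * cot (of_real pi * z) = (of_real pi * z * \<i>) * (1 + 2 / (exp w - 1))"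
        using cot_conv_exp[of "of_real pi * z"] e unfolding zw by (simp add: mult.assoc)
      also have "of_real pi * z * \<i> = w / 2"
        using zw by (simp add: field_simps)
      also have "w / 2 * (1 + 2 / (exp w - 1)) = w / 2 + w / (exp w - 1)"
        by (simp add: distrib_left)
      finally have "of_real pi * z * cot (of_real pi * z) = w / 2 + w / (exp w - 1)" .
      then have "(\<lambda>j. - 2 * zeta_even (j + 1) * z ^ (2 * j + 2)) sums (w / 2 + w / (exp w - 1) - 1)"
        using cot_power_series[OF \<open>z \<notin> \<int>\<close> nz] by simp
      also have "(\<lambda>j. - 2 * zeta_even (j + 1) * z ^ (2 * j + 2)) =
          (\<lambda>j. (\<lambda>n. if n \<ge> 2 then F $ n * w ^ n else 0) (2 * j + 2))"
        by (simp add: F_def z_def fun_eq_iff power_divide)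
      \<comment> \<open>The series runs over even n >= 2; the odd coefficients beyond degree 1 are
        zero, so it may be reindexed by all n.\<close>
      finally have "(\<lambda>n. if n \<ge> 2 then F $ n * w ^ n else 0) sums (w / 2 + w / (exp w - 1) - 1)"
      proof (subst (asm) sums_mono_reindex)
        show "strict_mono (\<lambda>j::nat. 2 * j + 2)" by (auto intro!: strict_monoI)
        fix n assume "n \<notin> range (\<lambda>j::nat. 2 * j + 2)"
        moreover have "n = 2 * (n div 2 - 1) + 2" if "n \<ge> 2" "even n"
          using that by auto
        ultimately have "\<not> (n \<ge> 2 \<and> even n)" by blast
        then show "(if n \<ge> 2 then F $ n * w ^ n else 0) = 0"
          by (auto simp: F_def)
      qed
      \<comment> \<open>Degrees 0 and 1 contribute 1 - w/2, which cancels the excess w/2 - 1 left by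
        the cotangent.\<close>
      from sums_add[OF sums_If_finite_set[of "{0, 1}" "\<lambda>n. F $ n * w ^ n"] this]
      have "(\<lambda>n. (if n \<in> {0, 1} then F $ n * w ^ n else 0) + (if n \<ge> 2 then F $ n * w ^ n else 0))
              sums ((\<Sum>n\<in>{0, 1}. F $ n * w ^ n) + (w / 2 + w / (exp w - 1) - 1))" by simp
      also have "(\<lambda>n. (if n \<in> {0, 1} then F $ n * w ^ n else 0) + (if n \<ge> 2 then F $ n * w ^ n else 0))
              = (\<lambda>n. F $ n * w ^ n)"
        by (auto simp: fun_eq_iff not_le less_2_cases_iff)
      also have "(\<Sum>n\<in>{0, 1}. F $ n * w ^ n) + (w / 2 + w / (exp w - 1) - 1) = w / (exp w - 1)"
        by (simp add: F_def)
      finally have "(\<lambda>n. F $ n * w ^ n) sums (w / (exp w - 1))" .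
      then show ?thesis using False by simp
    qed
  qed
qed

text \<open>Euler's formula: the expansion just found and the Bernoulli generating function both
  become X when multiplied by the nonzero series exp X - 1, so they agree in degree 2j.\<close>

lemma zeta_even_eq_bernoulli:
  assumes "j \<ge> 1"
  shows "zeta_even j = of_real ((- 1) ^ (j + 1) * bernoulli (2 * j) * (2 * pi) ^ (2 * j) / (2 * fact (2 * j)))"
proof -
  define F :: "complex fps" where "F = Abs_fps (\<lambda>n. if n = 0 then 1 else if n = 1 then - 1 / 2
                 else if even n then - 2 * zeta_even (n div 2) / (2 * of_real pi * \<i>) ^ n else 0)"
  let ?B = "Abs_fps (\<lambda>n. complex_of_real (bernoulli n / fact n))"
  let ?f = "\<lambda>w::complex. (if w = 0 then 1 else w / (exp w - 1)) * (exp w - 1)"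
  have 1: "?f has_fps_expansion F * (fps_exp 1 - 1)"
    using zeta_even_fps_expansion unfolding F_def [symmetric]
    by (intro has_fps_expansion_mult has_fps_expansion_diff has_fps_expansion_exp1 has_fps_expansion_1)
  have ev: "eventually (\<lambda>w. ?f w = w) (nhds 0)"
  proof -
    have "eventually (\<lambda>w. w \<in> ball (0::complex) 1) (nhds 0)"
      by (intro eventually_nhds_in_open) auto
    then show ?thesis
      by eventually_elim (auto simp: exp_eq_1_imp_zero)
  qed
  have "(\<lambda>w. w) has_fps_expansion F * (fps_exp 1 - 1)"
    using 1 ev unfolding has_fps_expansion_def by (auto elim: eventually_elim2)
  then have "F * (fps_exp 1 - 1) = fps_X"
    using has_fps_expansion_fps_X[where 'a=complex] by (intro fps_ext) (metis fps_nth_fps_expansion)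
  then have "F * (fps_exp 1 - 1) = ?B * (fps_exp 1 - 1)"
    by (simp only: bernoulli_fps_complex)
  then have "F = ?B"
    using fps_exp_minus_1_nonzero[where 'a=complex] by simp
  then have "F $ (2 * j) = ?B $ (2 * j)" by simp
  then have "- 2 * zeta_even j = of_real (bernoulli (2 * j) / fact (2 * j)) * (2 * of_real pi * \<i>) ^ (2 * j)"
    using assms pi_neq_zero by (simp add: F_def field_simps)
  also have "(2 * of_real pi * \<i>) ^ (2 * j) = ((- 1) * of_real ((2 * pi) ^ 2)) ^ j"
    unfolding power_mult by (simp add: power_mult_distrib)
  also have "\<dots> = (- 1) ^ j * of_real ((2 * pi) ^ (2 * j))"
    by (simp only: power_mult_distrib[of "- 1"] power_mult of_real_power)
  finally have *: "- 2 * zeta_even j = of_real ((- 1) ^ j * bernoulli (2 * j) * (2 * pi) ^ (2 * j) / fact (2 * j))"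
    by (simp add: mult_ac)
  have "zeta_even j = (- 2 * zeta_even j) / (- 2)" by simp
  also note *
  finally show ?thesis by (simp add: mult.commute)
qed

section \<open>Inversion of the cotangent series\<close>

lemma lattice_form_lower_bound:
  fixes \<tau> :: complex
  assumes "y \<ge> 0"
  shows "norm ((of_real x * \<tau>)\<^sup>2 - (of_real y)\<^sup>2) \<ge> (y * \<bar>Im \<tau>\<bar> / norm \<tau>)\<^sup>2"
proof (cases "\<tau> = 0")
  case False
  \<comment> \<open>Multiplying by \<open>cnj \<tau>\<close> makes the \<open>x\<close>-term real, so the imaginary part no longer depends on \<open>x\<close>.\<close>
  have *: "norm (of_real x * \<tau> + of_real u) \<ge> \<bar>u\<bar> * \<bar>Im \<tau>\<bar> / norm \<tau>" for u
  proof -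
    have "\<bar>u\<bar> * \<bar>Im \<tau>\<bar> = \<bar>Im ((of_real x * \<tau> + of_real u) * cnj \<tau>)\<bar>"
      by (simp add: abs_mult algebra_simps)
    also have "\<dots> \<le> norm ((of_real x * \<tau> + of_real u) * cnj \<tau>)"
      by (rule abs_Im_le_cmod)
    also have "\<dots> = norm (of_real x * \<tau> + of_real u) * norm \<tau>"
      by (simp add: norm_mult)
    finally show ?thesis using False by (simp add: divide_le_eq)
  qed
  have "(y * \<bar>Im \<tau>\<bar> / norm \<tau>) * (y * \<bar>Im \<tau>\<bar> / norm \<tau>)
      \<le> norm (of_real x * \<tau> + of_real y) * norm (of_real x * \<tau> + of_real (- y))"
    using *[of y] *[of "- y"] assms by (intro mult_mono) auto
  also have "\<dots> = norm ((of_real x * \<tau>)\<^sup>2 - (of_real y)\<^sup>2)"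
    by (simp add: norm_mult [symmetric] power2_eq_square algebra_simps)
  finally show ?thesis by (simp add: power2_eq_square)
qed auto

text \<open>Up to the factor i/2 this is H of the outline, for a general odd exponent; the theorem
  takes K = 2k.\<close>

definition cot_sum :: "nat \<Rightarrow> complex \<Rightarrow> complex" where
  "cot_sum K \<tau> = (\<Sum>n. cot (of_real pi * (of_nat (Suc n) * \<tau>)) / of_nat (Suc n) ^ (2 * K + 1))"

text \<open>The lower bound for the quadratic form grows like (m + 1)^2 uniformly in n, so the term
  is dominated by a product of a factor in n and a factor in m.\<close>

lemma lattice_sum_summable:
  fixes \<tau> :: complex
  assumes \<tau>: "Im \<tau> \<noteq> 0" and K: "K \<ge> 1"
  shows "(\<lambda>(n, m). 1 / (of_nat (Suc n) ^ (2 * K) * ((of_nat (Suc n) * \<tau>)\<^sup>2 - of_nat (Suc m) ^ 2)))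
           summable_on UNIV \<times> UNIV"
proof (rule summable_on_product_bound)
  define c where "c = (\<bar>Im \<tau>\<bar> / norm \<tau>)\<^sup>2"
  have c: "c > 0" using \<tau> by (auto simp: c_def)
  show "(\<lambda>n. 1 / of_nat (Suc n) ^ (2 * K) :: complex) summable_on UNIV"
    using has_sum_inverse_Suc_power[of "2 * K"] K by (auto simp: has_sum_imp_summable)
  show "(\<lambda>m. of_real (1 / c) * (1 / of_nat (Suc m) ^ 2) :: complex) summable_on UNIV"
    using has_sum_inverse_Suc_power[of 2] by (intro summable_on_cmult_right) (auto simp: has_sum_imp_summable)
  fix n m :: nat
  have "norm ((of_nat (Suc n) * \<tau>)\<^sup>2 - of_nat (Suc m) ^ 2) \<ge> c * real (Suc m) ^ 2"
    using lattice_form_lower_bound[of "real (Suc m)" \<tau> "real (Suc n)"]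
    by (simp add: c_def power_divide power_mult_distrib mult.commute del: of_nat_Suc)
  then have "1 / norm ((of_nat (Suc n) * \<tau>)\<^sup>2 - of_nat (Suc m) ^ 2) \<le> 1 / (c * real (Suc m) ^ 2)"
    using c by (intro frac_le) (auto simp del: of_nat_Suc)
  then have "1 / real (Suc n) ^ (2 * K) * (1 / norm ((of_nat (Suc n) * \<tau>)\<^sup>2 - of_nat (Suc m) ^ 2))
          \<le> 1 / real (Suc n) ^ (2 * K) * (1 / (c * real (Suc m) ^ 2))"
    by (intro mult_left_mono) auto
  then show "norm ((\<lambda>(n, m). 1 / (of_nat (Suc n) ^ (2 * K) * ((of_nat (Suc n) * \<tau>)\<^sup>2 - of_nat (Suc m) ^ 2))) (n, m))
     \<le> norm (1 / of_nat (Suc n) ^ (2 * K) :: complex) * norm (of_real (1 / c) * (1 / of_nat (Suc m) ^ 2) :: complex)"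
    using c by (simp add: norm_mult norm_divide norm_power del: of_nat_Suc)
qed

text \<open>Each row, summed over m, is a cotangent by \<open>cot_partial_fractions\<close> at z =
  (n + 1) \<tau>. The corrections 1/z add up to the term with zeta(2K + 2).\<close>

lemma cot_sum_lattice:
  fixes \<tau> :: complex
  assumes \<tau>: "Im \<tau> \<noteq> 0" and K: "K \<ge> 1"
    and S: "((\<lambda>(n, m). 1 / (of_nat (Suc n) ^ (2 * K) * ((of_nat (Suc n) * \<tau>)\<^sup>2 - of_nat (Suc m) ^ 2)))
           has_sum S) (UNIV \<times> UNIV)"
  shows "of_real pi * cot_sum K \<tau> = zeta_even (K + 1) / \<tau> + 2 * \<tau> * S"
proof -
  have \<tau>0: "\<tau> \<noteq> 0" using \<tau> by auto
  let ?N = "\<lambda>n. of_nat (Suc n) :: complex"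
  define T where "T = (\<lambda>n. (of_real pi * cot (of_real pi * (?N n * \<tau>)) - 1 / (?N n * \<tau>)) / (2 * \<tau> * ?N n ^ (2 * K + 1)))"
  have row: "((\<lambda>m. 1 / (?N n ^ (2 * K) * ((?N n * \<tau>)\<^sup>2 - ?N m ^ 2))) has_sum T n) UNIV" for n
  proof -
    \<comment> \<open>Unconditional summability of a row is inherited from the double series;
      partial fractions only identify its value as an ordinary limit.\<close>
    have "(\<lambda>m. 1 / (?N n ^ (2 * K) * ((?N n * \<tau>)\<^sup>2 - ?N m ^ 2))) summable_on UNIV"
      using summable_on_SigmaD1[OF lattice_sum_summable[OF \<tau> K], of n] by simp
    then obtain s where s: "((\<lambda>m. 1 / (?N n ^ (2 * K) * ((?N n * \<tau>)\<^sup>2 - ?N m ^ 2))) has_sum s) UNIV"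
      by (auto simp: summable_on_def)
    have "?N n * \<tau> \<notin> \<int>"
      using \<tau> by (auto elim!: Ints_cases simp: complex_eq_iff simp del: of_nat_Suc)
    from sums_divide[OF cot_partial_fractions[OF this], of "2 * \<tau> * ?N n ^ (2 * K + 1)"]
    have "(\<lambda>m. 2 * (?N n * \<tau>) / ((?N n * \<tau>)\<^sup>2 - ?N m ^ 2) / (2 * \<tau> * ?N n ^ (2 * K + 1))) sums T n"
      unfolding T_def .
    moreover have "2 * (?N n * \<tau>) / D / (2 * \<tau> * ?N n ^ (2 * K + 1)) = 1 / (?N n ^ (2 * K) * D)" for D
      using \<tau>0 by (simp add: field_simps del: of_nat_Suc)
    ultimately have "(\<lambda>m. 1 / (?N n ^ (2 * K) * ((?N n * \<tau>)\<^sup>2 - ?N m ^ 2))) sums T n"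
      by simp
    with has_sum_imp_sums[OF s] have "s = T n" by (rule sums_unique2)
    with s show ?thesis by simp
  qed
  have "(T has_sum S) UNIV"
    by (rule has_sum_SigmaD[OF S]) (use row in simp)
  then have "T sums S" by (rule has_sum_imp_sums)
  from sums_add[OF sums_mult[OF summable_sums[OF summable_inverse_Suc_power[of "2 * (K + 1)"]], of "1 / \<tau>"]
         sums_mult[OF this, of "2 * \<tau>"]]
  have "(\<lambda>n. 1 / \<tau> * (1 / ?N n ^ (2 * (K + 1))) + 2 * \<tau> * T n) sums (1 / \<tau> * zeta_even (K + 1) + 2 * \<tau> * S)"
    by (simp add: zeta_even_def)
  also have "(\<lambda>n. 1 / \<tau> * (1 / ?N n ^ (2 * (K + 1))) + 2 * \<tau> * T n)
      = (\<lambda>n. of_real pi * (cot (of_real pi * (?N n * \<tau>)) / ?N n ^ (2 * K + 1)))"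
    using \<tau>0 by (auto simp: fun_eq_iff T_def field_simps simp del: of_nat_Suc)
  finally have *: "(\<lambda>n. of_real pi * (cot (of_real pi * (?N n * \<tau>)) / ?N n ^ (2 * K + 1)))
       sums (1 / \<tau> * zeta_even (K + 1) + 2 * \<tau> * S)" .
  from sums_divide[OF this, of "of_real pi"] 
  have "cot_sum K \<tau> = (1 / \<tau> * zeta_even (K + 1) + 2 * \<tau> * S) / of_real pi"
    unfolding cot_sum_def by (intro sums_unique[symmetric]) simp
  then show ?thesis by simp
qed

lemma has_sum_product:
  fixes f :: "'a \<Rightarrow> complex" and g :: "'b \<Rightarrow> complex"
  assumes f: "(f has_sum F) A" and g: "(g has_sum G) B"
  shows "((\<lambda>(x, y). f x * g y) has_sum (F * G)) (A \<times> B)"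
proof -
  have "(\<lambda>(x, y). f x * g y) summable_on A \<times> B"
    using f g by (intro summable_on_product_bound[of f A g B]) (auto simp: norm_mult has_sum_imp_summable)
  then obtain S where S: "((\<lambda>(x, y). f x * g y) has_sum S) (A \<times> B)"
    by (auto simp: summable_on_def)
  have "((\<lambda>x. f x * G) has_sum S) A"
    by (rule has_sum_SigmaD[OF S]) (use has_sum_cmult_right[OF g] in simp)
  then show ?thesis
    using S has_sum_cmult_left[OF f, of G] has_sum_unique by blast
qed

text \<open>With A = (n \<tau>)^2, B = m^2 and D = A - B, the left side is -(A^K - B^K) / (n^(2K)
  m^(2K) D). Since D divides A^K - B^K, the denominator that couples n and m disappears and a finite
  sum of separated terms remains.\<close>

lemma lattice_term_identity:
  fixes n m \<tau> :: complex
  assumes "n \<noteq> 0" "m \<noteq> 0" "\<tau> \<noteq> 0" "(n * \<tau>)\<^sup>2 \<noteq> m\<^sup>2" "K \<ge> 1"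
  shows "1 / (n ^ (2 * K) * ((n * \<tau>)\<^sup>2 - m\<^sup>2)) + \<tau> ^ (2 * K - 2) * (1 / (m ^ (2 * K) * ((m * (1 / \<tau>))\<^sup>2 - n\<^sup>2)))
       = (\<Sum>j<K. - (\<tau> ^ (2 * j)) * (1 / n ^ (2 * (K - j)) * (1 / m ^ (2 * (j + 1)))))"
proof -
  define D where "D = (n * \<tau>)\<^sup>2 - m\<^sup>2"
  have D: "D \<noteq> 0" using assms by (simp add: D_def)
  obtain k where k: "K = Suc k" using assms by (cases K) auto
  have E: "(m * (1 / \<tau>))\<^sup>2 - n\<^sup>2 = - D / \<tau>\<^sup>2"
    using assms by (simp add: D_def field_simps)
  have "\<tau> ^ (2 * K - 2) * (1 / (m ^ (2 * K) * ((m * (1 / \<tau>))\<^sup>2 - n\<^sup>2))) = - (\<tau> ^ (2 * K) / (m ^ (2 * K) * D))"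
    unfolding E using assms D by (simp add: k field_simps power2_eq_square)
  moreover have "1 / (n ^ (2 * K) * D) - \<tau> ^ (2 * K) / (m ^ (2 * K) * D)
      = - (((n * \<tau>)\<^sup>2) ^ K - (m\<^sup>2) ^ K) / (n ^ (2 * K) * m ^ (2 * K) * D)"
  proof -
    have "((n * \<tau>)\<^sup>2) ^ K = n ^ (2 * K) * \<tau> ^ (2 * K)" "(m\<^sup>2) ^ K = m ^ (2 * K)"
      by (simp_all add: power_mult_distrib flip: power_mult)
    then show ?thesis using assms D by (simp only:) (simp add: field_simps)
  qed
  moreover have "((n * \<tau>)\<^sup>2) ^ K - (m\<^sup>2) ^ K = D * (\<Sum>j<K. (m\<^sup>2) ^ (K - Suc j) * ((n * \<tau>)\<^sup>2) ^ j)"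
    unfolding D_def by (rule power_diff_sumr2)
  ultimately have "1 / (n ^ (2 * K) * ((n * \<tau>)\<^sup>2 - m\<^sup>2)) + \<tau> ^ (2 * K - 2) * (1 / (m ^ (2 * K) * ((m * (1 / \<tau>))\<^sup>2 - n\<^sup>2)))
     = - (\<Sum>j<K. (m\<^sup>2) ^ (K - Suc j) * ((n * \<tau>)\<^sup>2) ^ j) / (n ^ (2 * K) * m ^ (2 * K))"
    using D by (simp flip: D_def)
  also have "\<dots> = (\<Sum>j<K. - ((m\<^sup>2) ^ (K - Suc j) * ((n * \<tau>)\<^sup>2) ^ j / (n ^ (2 * K) * m ^ (2 * K))))"
    by (simp add: sum_divide_distrib sum_negf)
  also have "\<dots> = (\<Sum>j<K. - (\<tau> ^ (2 * j)) * (1 / n ^ (2 * (K - j)) * (1 / m ^ (2 * (j + 1)))))"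
  proof (rule sum.cong)
    fix j assume "j \<in> {..<K}"
    then have j: "j < K" by simp
    have "2 * K = 2 * (K - j) + 2 * j" "2 * K = 2 * (j + 1) + 2 * (K - Suc j)"
      using j by auto
    then have "n ^ (2 * K) = n ^ (2 * (K - j)) * n ^ (2 * j)" "m ^ (2 * K) = m ^ (2 * (j + 1)) * m ^ (2 * (K - Suc j))"
      by (metis power_add)+
    then show "- ((m\<^sup>2) ^ (K - Suc j) * ((n * \<tau>)\<^sup>2) ^ j / (n ^ (2 * K) * m ^ (2 * K)))
        = - (\<tau> ^ (2 * j)) * (1 / n ^ (2 * (K - j)) * (1 / m ^ (2 * (j + 1))))"
      using assms by (simp add: power_mult power_mult_distrib)
  qed auto
  finally show ?thesis .
qed

text \<open>The lattice sum at 1/\<tau> with n and m exchanged is added, with weight \<tau>^(2K-2),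
  to the one at \<tau>. By \<open>lattice_term_identity\<close> the result splits into products of
  single sums, which are even zeta values.\<close>

lemma cot_sum_inversion:
  fixes \<tau> :: complex
  assumes \<tau>: "Im \<tau> \<noteq> 0" and K: "K \<ge> 1"
  shows "of_real pi * (cot_sum K \<tau> + \<tau> ^ (2 * K) * cot_sum K (1 / \<tau>)) =
           zeta_even (K + 1) * (1 / \<tau> + \<tau> ^ (2 * K + 1))
           - 2 * (\<Sum>j<K. \<tau> ^ (2 * j + 1) * zeta_even (j + 1) * zeta_even (K - j))"
proof -
  have \<tau>0: "\<tau> \<noteq> 0" using \<tau> by auto
  have \<tau>': "Im (1 / \<tau>) \<noteq> 0"
    using \<tau> by (auto simp: Im_divide power2_eq_square add_nonneg_eq_0_iff)
  let ?N = "\<lambda>n. of_nat (Suc n) :: complex"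
  let ?f = "\<lambda>\<tau>. \<lambda>(n, m). 1 / (?N n ^ (2 * K) * ((?N n * \<tau>)\<^sup>2 - ?N m ^ 2))"
  obtain S where S: "(?f \<tau> has_sum S) (UNIV \<times> UNIV)"
    using lattice_sum_summable[OF \<tau> K] by (auto simp: summable_on_def)
  obtain S' where S': "(?f (1 / \<tau>) has_sum S') (UNIV \<times> UNIV)"
    using lattice_sum_summable[OF \<tau>' K] by (auto simp: summable_on_def)
  have 1: "((\<lambda>p. ?f \<tau> p + \<tau> ^ (2 * K - 2) * (\<lambda>(n, m). ?f (1 / \<tau>) (m, n)) p)
              has_sum (S + \<tau> ^ (2 * K - 2) * S')) (UNIV \<times> UNIV)"
    using S'[unfolded has_sum_swap[of "?f (1 / \<tau>)"]]
    by (intro has_sum_add S has_sum_cmult_right)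
  have 2: "((\<lambda>p. \<Sum>j<k. - (\<tau> ^ (2 * j)) * (\<lambda>(n, m). 1 / ?N n ^ (2 * (K - j)) * (1 / ?N m ^ (2 * (j + 1)))) p)
          has_sum (\<Sum>j<k. - (\<tau> ^ (2 * j)) * (zeta_even (K - j) * zeta_even (j + 1)))) (UNIV \<times> UNIV)"
    if "k \<le> K" for k
    using that
  proof (induction k)
    case (Suc k)
    then show ?case unfolding sum.lessThan_Suc zeta_even_def
      by (intro has_sum_add has_sum_cmult_right has_sum_product has_sum_inverse_Suc_power) auto
  qed simp
  have "S + \<tau> ^ (2 * K - 2) * S' = (\<Sum>j<K. - (\<tau> ^ (2 * j)) * (zeta_even (K - j) * zeta_even (j + 1)))"
  proof (rule has_sum_unique[OF 1], rule has_sum_cong[THEN iffD1, OF _ 2[OF order_refl]])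
    fix p :: "nat \<times> nat"
    obtain n m where p: "p = (n, m)" by (cases p)
    have ne: "(?N n * \<tau>)\<^sup>2 \<noteq> (?N m)\<^sup>2"
    proof
      assume "(?N n * \<tau>)\<^sup>2 = (?N m)\<^sup>2"
      then have "?N n * \<tau> = ?N m \<or> ?N n * \<tau> = - ?N m"
        by (simp only: power2_eq_iff)
      then have "Im (?N n * \<tau>) = 0"
        by (elim disjE) (simp_all only: complex_Im_of_nat uminus_complex.sel minus_zero)
      then show False using \<tau> by (simp del: of_nat_Suc)
    qed
    show "(\<Sum>j<K. - (\<tau> ^ (2 * j)) * (\<lambda>(n, m). 1 / ?N n ^ (2 * (K - j)) * (1 / ?N m ^ (2 * (j + 1)))) p)
       = ?f \<tau> p + \<tau> ^ (2 * K - 2) * (\<lambda>(n, m). ?f (1 / \<tau>) (m, n)) p"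
      unfolding p prod.case
      by (rule lattice_term_identity[symmetric]) (use \<tau>0 ne K in \<open>simp_all del: of_nat_Suc\<close>)
  qed
  then have eq: "2 * \<tau> * (S + \<tau> ^ (2 * K - 2) * S')
      = - 2 * (\<Sum>j<K. \<tau> ^ (2 * j + 1) * zeta_even (j + 1) * zeta_even (K - j))"
    by (simp add: sum_distrib_left sum_negf mult_ac)
  \<comment> \<open>The prefactors 2 \<tau> and 2/\<tau> of the two lattice sums explain why the
    weight \<tau>^(2K) becomes \<tau>^(2K-2).\<close>
  have pow: "\<tau> ^ (2 * K) * (2 * (1 / \<tau>)) = 2 * \<tau> * \<tau> ^ (2 * K - 2)"
    using \<tau>0 K by (cases K) (auto simp: power2_eq_square)
  have "of_real pi * (cot_sum K \<tau> + \<tau> ^ (2 * K) * cot_sum K (1 / \<tau>))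
     = of_real pi * cot_sum K \<tau> + \<tau> ^ (2 * K) * (of_real pi * cot_sum K (1 / \<tau>))"
    by (simp add: algebra_simps)
  also have "\<dots> = zeta_even (K + 1) / \<tau> + 2 * \<tau> * S
        + \<tau> ^ (2 * K) * (zeta_even (K + 1) / (1 / \<tau>) + 2 * (1 / \<tau>) * S')"
    by (simp only: cot_sum_lattice[OF \<tau> K S] cot_sum_lattice[OF \<tau>' K S'])
  also have "\<dots> = zeta_even (K + 1) * (1 / \<tau> + \<tau> ^ (2 * K + 1)) + (2 * \<tau> * S + (\<tau> ^ (2 * K) * (2 * (1 / \<tau>))) * S')"
    by (simp add: algebra_simps)
  also have "(2 * \<tau> * S + (\<tau> ^ (2 * K) * (2 * (1 / \<tau>))) * S') = 2 * \<tau> * (S + \<tau> ^ (2 * K - 2) * S')"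
    unfolding pow by (simp add: algebra_simps)
  finally show ?thesis unfolding eq by simp
qed

section \<open>Lambert series at negative integers\<close>

text \<open>The summand of \<open>lambert_series\<close> at the negative integer -s, with a natural
  power in the denominator instead of \<open>powr\<close>.\<close>

definition lambert_term :: "nat \<Rightarrow> complex \<Rightarrow> nat \<Rightarrow> complex" where
  "lambert_term s q n = q ^ Suc n / (1 - q ^ Suc n) / of_nat (Suc n) ^ s"

lemma zeta_of_nat: "zeta (of_nat s) = (\<Sum>n. 1 / of_nat (Suc n) ^ s)"
  unfolding zeta_def by (simp add: powr_nat' del: of_nat_Suc)

lemma lambert_series_neg_of_nat: "lambert_series q (- of_nat s) = suminf (lambert_term s q)"
  unfolding lambert_series_def lambert_term_def [abs_def]
  by (simp add: powr_minus powr_nat' field_simps del: of_nat_Suc)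

text \<open>The denominators stay at least 1 - norm q away from 0, which leaves a geometric
  majorant.\<close>

lemma summable_lambert_term:
  assumes "norm q < 1"
  shows "summable (lambert_term s q)"
proof (rule summable_comparison_test')
  show "summable (\<lambda>n. norm q * (norm q ^ n * (1 / (1 - norm q))))"
    using assms by (intro summable_mult summable_mult2 summable_geometric) auto
  fix n :: nat
  have "norm q ^ Suc n \<le> norm q"
    using assms by (simp add: mult_left_le power_le_one)
  then have "1 - norm q \<le> 1 - norm (q ^ Suc n)"
    by (simp add: norm_power del: power_Suc)
  also have "\<dots> \<le> norm (1 - q ^ Suc n)"
    using norm_triangle_ineq2[of 1 "q ^ Suc n"] by simp
  finally have "norm q ^ Suc n / norm (1 - q ^ Suc n) \<le> norm q ^ Suc n / (1 - norm q)"
    using assms by (intro frac_le) auto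
  then have "norm q ^ Suc n / norm (1 - q ^ Suc n) / real (Suc n) ^ s \<le> norm q ^ Suc n / (1 - norm q) / 1"
    by (rule frac_le[rotated]) (use assms in \<open>auto simp del: of_nat_Suc power_Suc\<close>)
  then show "norm (lambert_term s q n) \<le> norm q * (norm q ^ n * (1 / (1 - norm q)))"
    by (simp add: lambert_term_def norm_divide norm_mult norm_power del: of_nat_Suc)
qed

text \<open>This gives real values at real q, and equal real parts at the two purely imaginary
  points r and -r of the main proof.\<close>

lemma lambert_series_cnj:
  "lambert_series (cnj q) (- of_nat s) = cnj (lambert_series q (- of_nat s))" if "norm q < 1"
proof -
  have "(\<lambda>n. cnj (lambert_term s q n)) sums cnj (suminf (lambert_term s q))"
    using summable_sums[OF summable_lambert_term[OF that]] by (simp only: sums_cnj)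
  then show ?thesis
    unfolding lambert_series_neg_of_nat
    by (intro sums_unique[symmetric]) (simp add: lambert_term_def [abs_def] del: of_nat_Suc)
qed

lemma power_neq_one_if_norm_less_one:
  fixes q :: complex
  assumes "norm q < 1"
  shows "q ^ Suc n \<noteq> 1"
proof -
  have "norm q ^ Suc n < 1"
    using assms by (simp add: power_less_one_iff del: power_Suc)
  then have "norm (q ^ Suc n) < 1"
    by (simp only: norm_power)
  then show ?thesis by auto
qed

text \<open>For Q = q^(n+1), Q / (1 - Q) + 1/2 equals i/2 times the cotangent; the halves add up to
  zeta(s)/2. The form with \<open>sums\<close> also records convergence of the cotangent
  series.\<close>

lemma lambert_series_sums_cot:
  assumes \<tau>: "Im \<tau> > 0" and K: "K \<ge> 1"
  shows "(\<lambda>n. cot (of_real pi * (of_nat (Suc n) * \<tau>)) / of_nat (Suc n) ^ (2 * K + 1)) sums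
     (2 / \<i> * (lambert_series (exp (2 * of_real pi * \<i> * \<tau>)) (- of_nat (2 * K + 1)) + zeta (of_nat (2 * K + 1)) / 2))"
proof -
  define q where "q = exp (2 * of_real pi * \<i> * \<tau>)"
  let ?s = "2 * K + 1"
  have q: "norm q < 1" using \<tau> by (simp add: q_def)
  have t: "lambert_term ?s q n + 1 / 2 * (1 / of_nat (Suc n) ^ ?s)
      = \<i> / 2 * (cot (of_real pi * (of_nat (Suc n) * \<tau>)) / of_nat (Suc n) ^ ?s)" for n
  proof -
    have "2 * \<i> * (of_real pi * (of_nat (Suc n) * \<tau>)) = of_nat (Suc n) * (2 * of_real pi * \<i> * \<tau>)"
      by (simp only: mult_ac)
    then have e: "exp (2 * \<i> * (of_real pi * (of_nat (Suc n) * \<tau>))) = q ^ Suc n"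
      unfolding q_def by (simp only: exp_of_nat_mult)
    define Q where "Q = q ^ Suc n"
    have Q: "Q \<noteq> 1"
      unfolding Q_def by (rule power_neq_one_if_norm_less_one[OF q])
    have "\<i> / 2 * cot (of_real pi * (of_nat (Suc n) * \<tau>)) = \<i> / 2 * (\<i> * (1 + 2 / (Q - 1)))"
      using cot_conv_exp[of "of_real pi * (of_nat (Suc n) * \<tau>)"] Q unfolding e Q_def by simp
    also have "\<dots> = - (1 / 2) - 1 / (Q - 1)"
      by (simp add: algebra_simps)
    also have "\<dots> = Q / (1 - Q) + 1 / 2"
      using Q by (simp add: divide_simps) (simp add: algebra_simps)
    finally have "\<i> / 2 * cot (of_real pi * (of_nat (Suc n) * \<tau>)) / of_nat (Suc n) ^ ?s
        = Q / (1 - Q) / of_nat (Suc n) ^ ?s + 1 / 2 / of_nat (Suc n) ^ ?s"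
      by (simp only: add_divide_distrib)
    then show ?thesis
      unfolding lambert_term_def Q_def[symmetric] by (simp only: times_divide_eq_right mult_1_right)
  qed
  have "(\<lambda>n. lambert_term ?s q n + 1 / 2 * (1 / of_nat (Suc n) ^ ?s)) sums
      (suminf (lambert_term ?s q) + 1 / 2 * (\<Sum>n. 1 / of_nat (Suc n) ^ ?s))"
    using q K by (intro sums_add sums_mult summable_sums summable_lambert_term summable_inverse_Suc_power) auto
  then have *: "(\<lambda>n. \<i> / 2 * (cot (of_real pi * (of_nat (Suc n) * \<tau>)) / of_nat (Suc n) ^ ?s)) sums
      (suminf (lambert_term ?s q) + 1 / 2 * (\<Sum>n. 1 / of_nat (Suc n) ^ ?s))"
    unfolding t .
  from sums_mult[OF *, of "2 / \<i>"] show ?thesis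
    unfolding lambert_series_neg_of_nat zeta_of_nat q_def[symmetric] by (simp del: of_nat_Suc)
qed

lemma lambert_series_cot_sum:
  assumes "Im \<tau> > 0" "K \<ge> 1"
  shows "lambert_series (exp (2 * of_real pi * \<i> * \<tau>)) (- of_nat (2 * K + 1)) + zeta (of_nat (2 * K + 1)) / 2
       = \<i> / 2 * cot_sum K \<tau>"
  unfolding cot_sum_def sums_unique[OF lambert_series_sums_cot[OF assms], symmetric] by simp

text \<open>Needed because 1/\<tau> lies in the lower half-plane, whereas the Lambert series
  requires -1/\<tau>.\<close>

lemma cot_sum_minus:
  assumes "Im \<tau> > 0" "K \<ge> 1"
  shows "cot_sum K (- \<tau>) = - cot_sum K \<tau>"
proof -
  have "cot (of_real pi * (of_nat (Suc n) * - \<tau>)) = - cot (of_real pi * (of_nat (Suc n) * \<tau>))" for n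
    by (simp add: cot_def)
  then show ?thesis
    unfolding cot_sum_def
    using suminf_minus[OF sums_summable[OF lambert_series_sums_cot[OF assms]]] by (simp del: of_nat_Suc)
qed

section \<open>The Hecke relation at 2\<close>

text \<open>For an odd summation index N the terms at r and -r add up to twice the term at r^2. For
  even N = 2M they coincide, and the deviation from that rule is a multiple of the M-th terms at r^2
  and r^4.\<close>

lemma lambert_series_duplication:
  assumes r: "norm r < 1"
  shows "lambert_series r (- of_nat s) + lambert_series (- r) (- of_nat s)
       = (2 + 2 / 2 ^ s) * lambert_series (r\<^sup>2) (- of_nat s) - 2 / 2 ^ s * lambert_series (r ^ 4) (- of_nat s)"
proof -
  let ?t = "lambert_term s"
  have norms: "norm (- r) < 1" "norm (r\<^sup>2) < 1" "norm (r ^ 4) < 1"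
    using r by (simp_all add: norm_power power_less_one_iff)
  note S = norms[THEN summable_lambert_term[of _ s], THEN summable_sums] 
    r[THEN summable_lambert_term[of _ s], THEN summable_sums]
  \<comment> \<open>The index is shifted, so odd n means an even summation index n + 1; e is the
    deviation at these indices.\<close>
  define e where "e = (\<lambda>n. if odd n then 2 * ?t r n - 2 * ?t (r\<^sup>2) n else 0)"
  have "(\<lambda>m. e (2 * m + 1)) = (\<lambda>m. 2 / 2 ^ s * ?t (r\<^sup>2) m - 2 / 2 ^ s * ?t (r ^ 4) m)"
  proof
    fix m
    have 1: "of_nat (Suc (2 * m + 1)) = (2 * of_nat (Suc m) :: complex)" by simp
    have 2: "r ^ Suc (2 * m + 1) = (r\<^sup>2) ^ Suc m" "(r\<^sup>2) ^ Suc (2 * m + 1) = (r ^ 4) ^ Suc m"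
      unfolding power_mult[symmetric] by (intro arg_cong[where f = "power r"]; simp)+
    have "odd (2 * m + 1)" by simp
    moreover have "2 * (x / (2 ^ s * y)) = 2 / 2 ^ s * (x / y)" for x y :: complex
      by simp
    ultimately show "e (2 * m + 1) = 2 / 2 ^ s * ?t (r\<^sup>2) m - 2 / 2 ^ s * ?t (r ^ 4) m"
      by (simp only: e_def lambert_term_def 1 2 power_mult_distrib not_False_eq_True if_True)
  qed
  moreover have "(\<lambda>m. 2 / 2 ^ s * ?t (r\<^sup>2) m - 2 / 2 ^ s * ?t (r ^ 4) m) sums
     (2 / 2 ^ s * suminf (?t (r\<^sup>2)) - 2 / 2 ^ s * suminf (?t (r ^ 4)))"
    by (intro sums_diff sums_mult S)
  ultimately have "(\<lambda>m. e (2 * m + 1)) sums (2 / 2 ^ s * suminf (?t (r\<^sup>2)) - 2 / 2 ^ s * suminf (?t (r ^ 4)))"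
    by simp
  then have "e sums (2 / 2 ^ s * suminf (?t (r\<^sup>2)) - 2 / 2 ^ s * suminf (?t (r ^ 4)))"
  proof (subst (asm) sums_mono_reindex)
    show "strict_mono (\<lambda>m::nat. 2 * m + 1)" by (auto intro!: strict_monoI)
    show "e n = 0" if "n \<notin> range (\<lambda>m. 2 * m + 1)" for n
      using that by (auto simp: e_def elim!: oddE)
  qed
  then have "(\<lambda>n. 2 * ?t (r\<^sup>2) n + e n) sums (2 * suminf (?t (r\<^sup>2)) + (2 / 2 ^ s * suminf (?t (r\<^sup>2)) - 2 / 2 ^ s * suminf (?t (r ^ 4))))"
    by (intro sums_add sums_mult S)
  also have "(\<lambda>n. 2 * ?t (r\<^sup>2) n + e n) = (\<lambda>n. ?t r n + ?t (- r) n)"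
  proof
    fix n
    show "2 * ?t (r\<^sup>2) n + e n = ?t r n + ?t (- r) n"
    proof (cases "even n")
      case False
      then have "(- r) ^ Suc n = r ^ Suc n" by (simp add: power_minus_odd)
      then show ?thesis using False by (simp add: e_def lambert_term_def del: of_nat_Suc power_Suc)
    next
      case True
      define Q where "Q = r ^ Suc n"
      have "(- r) ^ Suc n = - Q"
        using True by (simp add: Q_def)
      moreover have "(r\<^sup>2) ^ Suc n = Q\<^sup>2"
        unfolding Q_def power_mult[symmetric] by (simp only: mult.commute)
      ultimately have Q: "(- r) ^ Suc n = - Q" "(r\<^sup>2) ^ Suc n = Q\<^sup>2" by auto
      have "Q\<^sup>2 \<noteq> 1"
        using power_neq_one_if_norm_less_one[OF norms(2), of n] Q by simp
      then have "1 - Q \<noteq> 0" "1 + Q \<noteq> 0" "1 - Q\<^sup>2 \<noteq> 0" 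
        by (auto simp: power2_eq_1_iff add_eq_0_iff)
      then have "2 * (Q\<^sup>2 / (1 - Q\<^sup>2)) = Q / (1 - Q) + (- Q) / (1 + Q)"
        by (simp add: divide_simps) (auto simp: algebra_simps power2_eq_square)
      then have "2 * (Q\<^sup>2 / (1 - Q\<^sup>2)) / N = Q / (1 - Q) / N + (- Q) / (1 + Q) / N" for N
        by (simp only: add_divide_distrib)
      then show ?thesis using True
        unfolding e_def lambert_term_def Q unfolding Q_def[symmetric]
        by simp
    qed
  qed
  finally have "(\<lambda>n. ?t r n + ?t (- r) n) sums (2 * suminf (?t (r\<^sup>2)) + (2 / 2 ^ s * suminf (?t (r\<^sup>2)) - 2 / 2 ^ s * suminf (?t (r ^ 4))))" .
  from sums_unique2[OF sums_add[OF S(4) S(1)] this]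
  show ?thesis
    unfolding lambert_series_neg_of_nat by (simp add: algebra_simps)
qed

section \<open>Ramanujan's formula in terms of Bernoulli numbers\<close>

definition bernoulli_coeff :: "nat \<Rightarrow> real" where
  "bernoulli_coeff j = bernoulli (2 * j) / fact (2 * j)"

lemma bernoulli_0: "bernoulli 0 = 1"
  using arg_cong[OF bernoulli_fps_complex, of "\<lambda>F. fps_nth F 1"] by (simp add: fps_mult_nth)

lemma zeta_even_eq_bernoulli_coeff:
  assumes "j \<ge> 1"
  shows "zeta_even j = of_real ((- 1) ^ (j + 1) * bernoulli_coeff j * (2 * pi) ^ (2 * j) / 2)"
  using zeta_even_eq_bernoulli[OF assms] by (simp add: bernoulli_coeff_def field_simps)

text \<open>After Euler's formula the two outer terms with zeta(4k + 2) fit the pattern of the inner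
  sum at j = 0 and j = 2k + 1, because B_0 = 1. Everything merges into one sum.\<close>

lemma cot_sum_inversion_bernoulli:
  fixes \<tau> :: complex
  assumes \<tau>: "Im \<tau> \<noteq> 0" and k: "k \<ge> 1"
  shows "cot_sum (2 * k) \<tau> + \<tau> ^ (4 * k) * cot_sum (2 * k) (1 / \<tau>) =
           of_real ((2 * pi) ^ (4 * k + 1)) *
           (\<Sum>j\<le>2 * k + 1. \<tau> ^ (2 * j) / \<tau> * of_real (bernoulli_coeff j * bernoulli_coeff (2 * k + 1 - j)))"
proof -
  have \<tau>0: "\<tau> \<noteq> 0" using \<tau> by auto
  let ?b = bernoulli_coeff
  let ?C = "(2 * pi) ^ (4 * k + 2)"
  let ?f = "\<lambda>j. \<tau> ^ (2 * j) / \<tau> * of_real (?b j * ?b (2 * k + 1 - j))"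
  have b0: "?b 0 = 1"
    by (simp add: bernoulli_coeff_def bernoulli_0)
  have split: "(\<Sum>j\<le>n + 1. g j) = g 0 + (\<Sum>j<n. g (Suc j)) + g (n + 1)" for g :: "nat \<Rightarrow> complex" and n
    using sum.lessThan_Suc_shift[of g n] by (simp add: lessThan_Suc_atMost)
  have top: "zeta_even (2 * k + 1) = of_real (?C / 2 * ?b (2 * k + 1))"
    by (subst zeta_even_eq_bernoulli_coeff) (auto simp: algebra_simps)
  have inner: "\<tau> ^ (2 * j + 1) * zeta_even (j + 1) * zeta_even (2 * k - j)
       = - of_real (?C / 4) * ?f (Suc j)" if "j < 2 * k" for j
  proof -
    have "zeta_even (j + 1) * zeta_even (2 * k - j) =
        of_real (((- 1) ^ (j + 2) * (- 1) ^ (2 * k - j + 1)) * ((2 * pi) ^ (2 * (j + 1)) * (2 * pi) ^ (2 * (2 * k - j)))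
           / 4 * (?b (j + 1) * ?b (2 * k - j)))"
      using that by (subst (1 2) zeta_even_eq_bernoulli_coeff) (simp_all add: mult_ac)
    \<comment> \<open>The exponents add up to 2k + 3, so the sign is the same for every j.\<close>
    also have "(- 1) ^ (j + 2) * (- 1) ^ (2 * k - j + 1) = (- 1 :: real)"
    proof -
      have "j + 2 + (2 * k - j + 1) = Suc (2 * (k + 1))" using that by simp
      then show ?thesis by (simp only: power_add[symmetric]) simp
    qed
    also have "(2 * pi) ^ (2 * (j + 1)) * (2 * pi) ^ (2 * (2 * k - j)) = ?C"
    proof -
      have "2 * (j + 1) + 2 * (2 * k - j) = 4 * k + 2" using that by simp
      then show ?thesis by (simp only: power_add[symmetric])
    qed
    finally have "zeta_even (j + 1) * zeta_even (2 * k - j) = of_real (- 1 * ?C / 4 * (?b (j + 1) * ?b (2 * k - j)))" .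
    moreover have "\<tau> ^ (2 * Suc j) / \<tau> = \<tau> ^ (2 * j + 1)"
      using \<tau>0 by simp
    moreover have "2 * k + 1 - Suc j = 2 * k - j" by simp
    ultimately show ?thesis
      by (simp only: mult.assoc) (simp add: mult_ac)
  qed
  have "of_real pi * (cot_sum (2 * k) \<tau> + \<tau> ^ (4 * k) * cot_sum (2 * k) (1 / \<tau>)) =
      zeta_even (2 * k + 1) * (1 / \<tau> + \<tau> ^ (4 * k + 1))
           - 2 * (\<Sum>j<2 * k. \<tau> ^ (2 * j + 1) * zeta_even (j + 1) * zeta_even (2 * k - j))"
    using cot_sum_inversion[OF \<tau>, of "2 * k"] k by (simp add: mult.assoc[symmetric])
  also have "(\<Sum>j<2 * k. \<tau> ^ (2 * j + 1) * zeta_even (j + 1) * zeta_even (2 * k - j))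
      = - of_real (?C / 4) * (\<Sum>j<2 * k. ?f (Suc j))"
    unfolding sum_distrib_left by (intro sum.cong inner) auto
  also have "zeta_even (2 * k + 1) * (1 / \<tau> + \<tau> ^ (4 * k + 1)) = of_real (?C / 2) * (?f 0 + ?f (2 * k + 1))"
    using \<tau>0 unfolding top by (simp add: b0 algebra_simps)
  also have "of_real (?C / 2) * (?f 0 + ?f (2 * k + 1)) - 2 * (- of_real (?C / 4) * (\<Sum>j<2 * k. ?f (Suc j)))
     = of_real (?C / 2) * (?f 0 + (\<Sum>j<2 * k. ?f (Suc j)) + ?f (2 * k + 1))"
    by (simp add: algebra_simps del: power_Suc)
  also have "?f 0 + (\<Sum>j<2 * k. ?f (Suc j)) + ?f (2 * k + 1) = (\<Sum>j\<le>2 * k + 1. ?f j)"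
    by (rule split[symmetric])
  \<comment> \<open>One factor pi is split off to cancel the pi on the left.\<close>
  also have "complex_of_real (?C / 2) = of_real pi * of_real ((2 * pi) ^ (4 * k + 1))"
    by (simp add: mult_ac)
  finally show ?thesis
    by (simp add: mult.assoc del: of_real_mult of_real_power)
qed

section \<open>The point (1 + i sqrt 7) / 2\<close>

text \<open>From cot \<theta> = sqrt 7 and sin^2 + cos^2 = 1 follows 8 sin^2 \<theta> = 1, and
  positivity of the sine picks the root. The polar form turns powers of the point into cosines of
  multiples of \<theta>.\<close>

lemma sqrt7_point_polar:
  assumes "0 < \<theta>" "\<theta> < pi / 2" "cot \<theta> = sqrt 7"
  shows "Complex (1 / 2) (sqrt 7 / 2) = of_real (sqrt 2) * cis (pi / 2 - \<theta>)"
proof -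
  have s: "sin \<theta> > 0" using assms by (intro sin_gt_zero) auto
  have c: "cos \<theta> = sqrt 7 * sin \<theta>"
    using assms(3) s by (simp add: cot_def field_simps)
  have "sin \<theta> ^ 2 + (sqrt 7 * sin \<theta>) ^ 2 = 1"
    using sin_cos_squared_add[of \<theta>] unfolding c .
  then have "(2 * (sqrt 2 * sin \<theta>))\<^sup>2 = 1\<^sup>2"
    by (simp add: power_mult_distrib)
  then have "2 * (sqrt 2 * sin \<theta>) = 1"
    by (rule power2_eq_imp_eq) (use s in auto)
  then show ?thesis
    by (simp add: complex_eq_iff cos_diff sin_diff c)
qed

lemma sqrt2_power_even: "sqrt 2 ^ (2 * n) = 2 ^ n"
  by (simp add: power_mult)

context
  fixes \<alpha> :: complex and \<theta> :: real and k :: nat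
  assumes \<alpha>_polar: "\<alpha> = of_real (sqrt 2) * cis (pi / 2 - \<theta>)"
begin

lemma \<alpha>_power: "\<alpha> ^ n = of_real (sqrt 2 ^ n) * cis (of_nat n * (pi / 2 - \<theta>))"
  by (simp add: \<alpha>_polar power_mult_distrib Complex.DeMoivre)

lemma Re_inverse_\<alpha>_power: "Re (1 / \<alpha> ^ (4 * k)) = cos (4 * real k * \<theta>) / 2 ^ (2 * k)"
proof -
  have pow: "complex_of_real (sqrt 2 ^ (4 * k)) = complex_of_real (2 ^ (2 * k))"
    using sqrt2_power_even[of "2 * k"] by simp
  have "1 / \<alpha> ^ (4 * k) = of_real (1 / 2 ^ (2 * k)) * (cis 0 / cis (of_nat (4 * k) * (pi / 2 - \<theta>)))"
    unfolding \<alpha>_power pow by simp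
  also have "cis 0 / cis (of_nat (4 * k) * (pi / 2 - \<theta>)) = cis (0 - of_nat (4 * k) * (pi / 2 - \<theta>))"
    by (rule cis_divide)
  also have "0 - (of_nat (4 * k) * (pi / 2 - \<theta>)) = 4 * real k * \<theta> - 2 * real k * pi"
    by (simp add: algebra_simps)
  finally show ?thesis
    by (simp add: cos_diff)
qed

text \<open>The argument is pi/2 + (2j - 1 - 4k)(pi/2 - \<theta>) = (4k + 1 - 2j) \<theta> + j pi -
  2k pi, where the first pi/2 comes from the factor i. The multiple j pi gives the sign and 2k pi
  drops out.\<close>

lemma Re_period_term:
  "Re (\<i> * (\<alpha> ^ (2 * j) / \<alpha>) / \<alpha> ^ (4 * k))
     = (- 1) ^ j * (2 ^ j / (sqrt 2 * 2 ^ (2 * k)) * cos ((4 * real k + 1 - 2 * real j) * \<theta>))"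
proof -
  let ?\<phi> = "pi / 2 - \<theta>"
  have "\<i> * (\<alpha> ^ (2 * j) / \<alpha>) / \<alpha> ^ (4 * k)
      = of_real (2 ^ j / (sqrt 2 * 2 ^ (2 * k))) *
          (cis (pi / 2) * (cis (of_nat (2 * j) * ?\<phi>) / cis ?\<phi>) / cis (of_nat (4 * k) * ?\<phi>))"
    using sqrt2_power_even[of j] sqrt2_power_even[of "2 * k"] unfolding \<alpha>_power
    by (simp add: \<alpha>_polar cis_pi_half mult_ac)
  also have "cis (pi / 2) * (cis (of_nat (2 * j) * ?\<phi>) / cis ?\<phi>) / cis (of_nat (4 * k) * ?\<phi>)
      = cis (pi / 2 + (of_nat (2 * j) * ?\<phi> - ?\<phi>) - of_nat (4 * k) * ?\<phi>)"
    by (simp only: cis_mult cis_divide)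
  also have "pi / 2 + (of_nat (2 * j) * ?\<phi> - ?\<phi>) - of_nat (4 * k) * ?\<phi>
      = ((4 * real k + 1 - 2 * real j) * \<theta> + real j * pi) - 2 * real k * pi"
    by (simp add: algebra_simps)
  finally have "Re (\<i> * (\<alpha> ^ (2 * j) / \<alpha>) / \<alpha> ^ (4 * k)) =
      2 ^ j / (sqrt 2 * 2 ^ (2 * k)) * cos (((4 * real k + 1 - 2 * real j) * \<theta> + real j * pi) - 2 * real k * pi)"
    by (simp del: of_real_divide of_real_mult of_real_power)
  also have "cos (((4 * real k + 1 - 2 * real j) * \<theta> + real j * pi) - 2 * real k * pi)
     = (- 1) ^ j * cos ((4 * real k + 1 - 2 * real j) * \<theta>)"
    by (simp only: cos_diff[of _ "2 * real k * pi"] cos_add[of _ "real j * pi"] cos_2npi sin_2npi cos_npi sin_npi)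
       simp
  finally show ?thesis by simp
qed

end

section \<open>The coefficients of the theorem\<close>

text \<open>Folding j with 2k + 1 - j is what shortens Ramanujan's sum to the range j <= k of the
  theorem.\<close>

lemma sum_reflect_odd:
  fixes g :: "nat \<Rightarrow> real"
  shows "(\<Sum>j\<le>2 * k + 1. g j) = (\<Sum>j\<le>k. g j + g (2 * k + 1 - j))"
proof -
  have "(\<Sum>j\<le>2 * k + 1. g j) = (\<Sum>j\<in>{..k} \<union> {k+1..2*k+1}. g j)"
    by (intro sum.cong) auto
  also have "\<dots> = (\<Sum>j\<le>k. g j) + (\<Sum>j=k+1..2*k+1. g j)"
    by (intro sum.union_disjoint) auto
  also have "(\<Sum>j=k+1..2*k+1. g j) = (\<Sum>j\<le>k. g (2 * k + 1 - j))"
    by (rule sum.reindex_bij_witness[of _ "\<lambda>j. 2 * k + 1 - j" "\<lambda>j. 2 * k + 1 - j"]) auto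
  finally show ?thesis by (simp add: sum.distrib)
qed

text \<open>The common denominator of the coefficients, positive because 2^(2k) > 1 for k >=
  1.\<close>

lemma one_minus_cos_pos:
  assumes "k \<ge> 1"
  shows "1 - cos x / 2 ^ (2 * k) > (0::real)"
proof -
  have "(1::real) < 2 ^ (2 * k)"
    using assms by (intro one_less_power) auto
  moreover have "cos x \<le> 1" by simp
  ultimately have "cos x < 2 ^ (2 * k)" by linarith
  then show ?thesis by simp
qed

lemma coeff_a_eq:
  "coeff_a \<theta> k = (2 + 1 / 2 ^ (4 * k) - 2 * (cos (4 * real k * \<theta>) / 2 ^ (2 * k))) / (1 - cos (4 * real k * \<theta>) / 2 ^ (2 * k))"
proof -
  have "2 powr (- 4 * real k) = 1 / 2 ^ (4 * k)" "2 powr (- 2 * real k) = 1 / 2 ^ (2 * k)"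
    using powr_realpow[of 2 "4 * k"] powr_realpow[of 2 "2 * k"] by (simp_all add: powr_minus field_simps)
  moreover from this have "2 powr (- 2 * real k + 1) = 2 * (1 / 2 ^ (2 * k))"
    by (simp only: powr_add powr_one)
  ultimately show ?thesis
    by (simp only: coeff_a_def) simp
qed

lemma coeff_b_eq:
  fixes \<theta> k
  defines "E \<equiv> 1 / 2 ^ (2 * k)"
  shows "coeff_b \<theta> k = - ((4 + 3 * E ^ 2 + E ^ 4 - 4 * E * cos (4 * real k * \<theta>) - 2 * E ^ 3 * cos (4 * real k * \<theta>))
       / (1 - E * cos (4 * real k * \<theta>)))"
proof -
  have E: "E = 2 powr (- 2 * real k)"
    using powr_realpow[of 2 "2 * k"] by (simp add: E_def powr_minus field_simps)
  have "2 powr (- 4 * real k) = E ^ 2" "2 powr (- 8 * real k) = E ^ 4"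
       "2 powr (- 2 * real k + 2) = 4 * E" "2 powr (- 6 * real k + 1) = 2 * E ^ 3"
    unfolding E by (simp_all only: powr_add powr_power) (simp_all add: powr_numeral)
  then show ?thesis
    unfolding coeff_b_def E[symmetric] by (simp only: mult.assoc)
qed

text \<open>Numerator and denominator are divided by 2^(2k), so that c has the same denominator as a
  and b.\<close>

lemma coeff_c_eq:
  "coeff_c \<theta> j k = (sqrt 2 / 2 ^ j * cos ((2 * real j - 1) * \<theta>)
       - 2 ^ j / (sqrt 2 * 2 ^ (2 * k)) * cos ((4 * real k + 1 - 2 * real j) * \<theta>)) / (1 - cos (4 * real k * \<theta>) / 2 ^ (2 * k))"
proof -
  have p: "2 powr (2 * real k) = 2 ^ (2 * k)" "2 powr real j = 2 ^ j" "2 powr (1 / 2) = sqrt 2"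
    using powr_realpow[of 2 "2 * k"] by (simp_all add: powr_realpow powr_half_sqrt)
  have "2 powr (2 * real k + 1 / 2 - real j) = 2 ^ (2 * k) * sqrt 2 / 2 ^ j"
       "2 powr (real j - 1 / 2) = 2 ^ j / sqrt 2"
    by (simp_all only: powr_add powr_diff p)
  then have "coeff_c \<theta> j k = (2 ^ (2 * k) * sqrt 2 / 2 ^ j * cos ((2 * real j - 1) * \<theta>)
       - 2 ^ j / sqrt 2 * cos ((4 * real k + 1 - 2 * real j) * \<theta>)) / (2 ^ (2 * k) - cos (4 * real k * \<theta>))"
    by (simp add: coeff_c_def p)
  also have "\<dots> = (2 ^ (2 * k) * (sqrt 2 / 2 ^ j * cos ((2 * real j - 1) * \<theta>)
       - 2 ^ j / (sqrt 2 * 2 ^ (2 * k)) * cos ((4 * real k + 1 - 2 * real j) * \<theta>)))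
          / (2 ^ (2 * k) * (1 - cos (4 * real k * \<theta>) / 2 ^ (2 * k)))"
    by (simp add: algebra_simps)
  finally show ?thesis by simp
qed

text \<open>The indices j and 2k + 1 - j carry opposite signs and the same product of b's.
  Reflection turns the second cosine term of c into the first, so each pair gives -c times the
  common denominator.\<close>

lemma period_sum_coeff_c:
  fixes b :: "nat \<Rightarrow> real"
  assumes "k \<ge> 1"
  shows "(\<Sum>j\<le>2 * k + 1. (- 1) ^ j * (2 ^ j / (sqrt 2 * 2 ^ (2 * k)) * cos ((4 * real k + 1 - 2 * real j) * \<theta>))
            * (b j * b (2 * k + 1 - j)))
     = - (1 - cos (4 * real k * \<theta>) / 2 ^ (2 * k)) * (\<Sum>j=0..k. (- 1) ^ j * coeff_c \<theta> j k * (b j * b (2 * k + 1 - j)))"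
proof -
  let ?d = "1 - cos (4 * real k * \<theta>) / 2 ^ (2 * k)"
  have d: "?d \<noteq> 0" using one_minus_cos_pos[OF assms] by (metis less_irrefl)
  let ?u = "\<lambda>j. 2 ^ j / (sqrt 2 * 2 ^ (2 * k)) * cos ((4 * real k + 1 - 2 * real j) * \<theta>)"
  let ?v = "\<lambda>j. sqrt 2 / 2 ^ j * cos ((2 * real j - 1) * \<theta>)"
  have "(- 1) ^ j * ?u j * (b j * b (2 * k + 1 - j))
       + (- 1) ^ (2 * k + 1 - j) * ?u (2 * k + 1 - j) * (b (2 * k + 1 - j) * b (2 * k + 1 - (2 * k + 1 - j)))
     = - ?d * ((- 1) ^ j * coeff_c \<theta> j k * (b j * b (2 * k + 1 - j)))" if j: "j \<le> k" for j
  proof -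
    have sgn: "(- 1) ^ (2 * k + 1 - j) = - ((- 1) ^ j :: real)"
      using j by (simp add: minus_one_power_iff)
    have "4 * real k + 1 - 2 * real (2 * k + 1 - j) = 2 * real j - 1"
      using j by (simp add: of_nat_diff)
    moreover have "2 ^ (2 * k + 1 - j) / (sqrt 2 * 2 ^ (2 * k)) = sqrt 2 / 2 ^ j"
    proof -
      have "(2::real) ^ (2 * k + 1 - j) = 2 * 2 ^ (2 * k) / 2 ^ j"
        using j by (subst power_diff) auto
      then show ?thesis by (simp add: field_simps)
    qed
    ultimately have u: "?u (2 * k + 1 - j) = ?v j" by simp
    have c: "?d * coeff_c \<theta> j k = ?v j - ?u j"
      using d unfolding coeff_c_eq by simp
    have "2 * k + 1 - (2 * k + 1 - j) = j" using j by simp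
    then have "(- 1) ^ j * ?u j * (b j * b (2 * k + 1 - j))
       + (- 1) ^ (2 * k + 1 - j) * ?u (2 * k + 1 - j) * (b (2 * k + 1 - j) * b (2 * k + 1 - (2 * k + 1 - j)))
       = - ((- 1) ^ j * (?v j - ?u j) * (b j * b (2 * k + 1 - j)))"
      unfolding sgn u by (simp add: algebra_simps)
    also have "\<dots> = - ?d * ((- 1) ^ j * coeff_c \<theta> j k * (b j * b (2 * k + 1 - j)))"
      unfolding c[symmetric] by (simp only: mult_ac mult_minus_left mult_minus_right)
    finally show ?thesis .
  qed
  then show ?thesis
    unfolding sum_reflect_odd sum_distrib_left by (intro sum.cong) (auto simp: atLeast0AtMost)
qed

section \<open>Real values and inversion of Lambert series\<close>

lemma lambert_series_of_real:
  assumes "\<bar>y\<bar> < 1"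
  shows "lambert_series (of_real y) (- of_nat s) = of_real (Re (lambert_series (of_real y) (- of_nat s)))"
proof -
  have "cnj (lambert_series (of_real y) (- of_nat s)) = lambert_series (of_real y) (- of_nat s)"
    using lambert_series_cnj[of "of_real y" s] assms by simp
  then show ?thesis
    by (simp add: complex_eq_iff)
qed

lemma zeta_of_nat_real:
  assumes "s \<ge> 2"
  shows "zeta (of_nat s) = of_real (Re (zeta (of_nat s)))"
proof -
  have "(\<lambda>n. complex_of_real (1 / of_nat (Suc n) ^ s)) sums of_real (\<Sum>n. 1 / of_nat (Suc n) ^ s)"
    by (intro sums_of_real summable_sums summable_inverse_Suc_power assms)
  then have "zeta (of_nat s) = of_real (\<Sum>n. 1 / of_nat (Suc n) ^ s)"
    unfolding zeta_of_nat by (intro sums_unique[symmetric]) (simp del: of_nat_Suc)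
  then show ?thesis by simp
qed

text \<open>Ramanujan's formula solved for H(-1/\<tau>), the quantity to be eliminated. The factors
  i and \<tau>^(-4k) are moved into the sum to match \<open>Re_period_term\<close>.\<close>

lemma lambert_series_inversion:
  fixes \<tau> :: complex
  assumes \<tau>: "Im \<tau> > 0" and k: "k \<ge> 1"
  defines "H \<equiv> \<lambda>\<tau>. lambert_series (exp (2 * of_real pi * \<i> * \<tau>)) (- of_nat (4 * k + 1)) + zeta (of_nat (4 * k + 1)) / 2"
  shows "H (- (1 / \<tau>)) = H \<tau> / \<tau> ^ (4 * k) - of_real ((2 * pi) ^ (4 * k + 1) / 2) *
           (\<Sum>j\<le>2 * k + 1. \<i> * (\<tau> ^ (2 * j) / \<tau>) / \<tau> ^ (4 * k) * of_real (bernoulli_coeff j * bernoulli_coeff (2 * k + 1 - j)))"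
proof -
  have \<tau>0: "\<tau> \<noteq> 0" using \<tau> by auto
  have \<tau>': "Im (- (1 / \<tau>)) > 0"
    using \<tau> by (simp add: Im_divide sum_power2_gt_zero_iff)
  have s: "2 * (2 * k) + 1 = 4 * k + 1" by simp
  let ?S = "\<Sum>j\<le>2 * k + 1. \<tau> ^ (2 * j) / \<tau> * of_real (bernoulli_coeff j * bernoulli_coeff (2 * k + 1 - j))"
  have 1: "H \<tau> = \<i> / 2 * cot_sum (2 * k) \<tau>"
    using lambert_series_cot_sum[OF \<tau>, of "2 * k"] k unfolding H_def s by simp
  have 2: "H (- (1 / \<tau>)) = - (\<i> / 2 * cot_sum (2 * k) (1 / \<tau>))"
    using lambert_series_cot_sum[OF \<tau>', of "2 * k"] cot_sum_minus[OF \<tau>', of "2 * k"] k unfolding H_def s by simp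
  have "H \<tau> - \<tau> ^ (4 * k) * H (- (1 / \<tau>)) = \<i> / 2 * (cot_sum (2 * k) \<tau> + \<tau> ^ (4 * k) * cot_sum (2 * k) (1 / \<tau>))"
    unfolding 1 2 by (simp add: algebra_simps)
  also have "\<dots> = \<i> / 2 * (of_real ((2 * pi) ^ (4 * k + 1)) * ?S)"
    using cot_sum_inversion_bernoulli[of \<tau> k] \<tau> k by simp
  finally have "H (- (1 / \<tau>)) = H \<tau> / \<tau> ^ (4 * k) - of_real ((2 * pi) ^ (4 * k + 1) / 2) * (\<i> * ?S / \<tau> ^ (4 * k))"
    using \<tau>0 by (simp add: divide_simps) (simp add: algebra_simps)
  also have "\<i> * ?S / \<tau> ^ (4 * k) = (\<Sum>j\<le>2 * k + 1. \<i> * (\<tau> ^ (2 * j) / \<tau>) / \<tau> ^ (4 * k) * of_real (bernoulli_coeff j * bernoulli_coeff (2 * k + 1 - j)))"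
    unfolding sum_distrib_left sum_divide_distrib by (intro sum.cong) auto
  finally show ?thesis .
qed

section \<open>Elimination at the point \<alpha> = (1 + i sqrt 7)/2\<close>

theorem theorem4p4:
  fixes \<theta> :: real and k :: nat
  assumes "0 < \<theta>" "\<theta> < pi / 2" "cot \<theta> = sqrt 7"
    and "k \<ge> 1"
  shows "zeta (of_nat (4 * k + 1)) =
    of_real ((2 * pi) ^ (4 * k + 1) *
      (\<Sum>j=0..k. (-1) ^ j * coeff_c \<theta> j k * bernoulli (2 * j) * bernoulli (4 * k + 2 - 2 * j)
                 / (fact (2 * j) * fact (4 * k + 2 - 2 * j))))
    + of_real (coeff_a \<theta> k)
        * lambert_series (of_real (exp (- sqrt 7 * pi))) (- 4 * of_nat k - 1)
    + of_real (coeff_b \<theta> k)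
        * lambert_series (of_real (exp (- 2 * sqrt 7 * pi))) (- 4 * of_nat k - 1)
    + of_real (2 powr (- 4 * real k) * coeff_a \<theta> k)
        * lambert_series (of_real (exp (- 4 * sqrt 7 * pi))) (- 4 * of_nat k - 1)"
proof -
  define s where "s = 4 * k + 1"
  have exponent: "- 4 * of_nat k - 1 = (- of_nat s :: complex)"
    by (simp add: s_def)
  define \<Lambda> where "\<Lambda> = (\<lambda>q. lambert_series q (- of_nat s))"
  have \<Lambda>: "lambert_series q (- of_nat s) = \<Lambda> q" for q
    by (simp add: \<Lambda>_def)
  define x where "x = exp (- sqrt 7 * pi)"
  \<comment> \<open>This r is exp (i pi \<alpha>), a square root of the nome -x belonging to
    \<alpha>.\<close>
  define r :: complex where "r = \<i> * of_real (exp (- sqrt 7 * pi / 2))"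
  define \<alpha> where "\<alpha> = Complex (1 / 2) (sqrt 7 / 2)"
  have \<alpha>_polar: "\<alpha> = of_real (sqrt 2) * cis (pi / 2 - \<theta>)"
    unfolding \<alpha>_def using assms(1-3) by (rule sqrt7_point_polar)

  have x: "0 < x" "x < 1" by (simp_all add: x_def)
  have x_powers: "exp (- 2 * sqrt 7 * pi) = x ^ 2" "exp (- 4 * sqrt 7 * pi) = x ^ 4"
    by (simp_all add: x_def flip: exp_of_nat_mult)
  have r2: "r\<^sup>2 = - of_real x"
    by (simp add: r_def x_def power_mult_distrib flip: of_real_power exp_of_nat_mult)
  have r4: "r ^ 4 = (of_real x)\<^sup>2"
  proof -
    have "r ^ 4 = (r\<^sup>2)\<^sup>2" by simp
    then show ?thesis unfolding r2 by simp
  qed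
  have norm_r: "norm r < 1" by (simp add: r_def norm_mult)
  have cnj_r: "cnj (- r) = r" by (simp add: r_def)

  have q_\<alpha>: "exp (2 * of_real pi * \<i> * \<alpha>) = - of_real x"
  proof -
    have "2 * of_real pi * \<i> * \<alpha> = of_real (- sqrt 7 * pi) + of_real pi * \<i>"
      by (simp add: \<alpha>_def complex_eq_iff)
    then show ?thesis by (simp only: exp_add exp_pi_i x_def exp_of_real) simp
  qed
  \<comment> \<open>Complex multiplication enters here: \<alpha>^2 - \<alpha> + 2 = 0 gives
    -1/\<alpha> = (\<alpha> - 1)/2, and the shift by -1/2 turns r into -r.\<close>
  have q_inv: "exp (2 * of_real pi * \<i> * (- (1 / \<alpha>))) = - r"
  proof -
    have "\<alpha> * (1 - \<alpha>) = 2" "\<alpha> \<noteq> 0"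
      by (simp_all add: \<alpha>_def complex_eq_iff)
    then have "- (1 / \<alpha>) = (\<alpha> - 1) / 2" by (simp add: field_simps)
    then have "2 * of_real pi * \<i> * (- (1 / \<alpha>)) = 2 * of_real pi * \<i> * ((\<alpha> - 1) / 2)"
      by (simp only:)
    also have "\<dots> = of_real (- sqrt 7 * pi / 2) + - (of_real (pi / 2) * \<i>)"
      by (simp add: \<alpha>_def complex_eq_iff)
    finally have "exp (2 * of_real pi * \<i> * (- (1 / \<alpha>))) = exp (of_real (- sqrt 7 * pi / 2)) * inverse (cis (pi / 2))"
      by (simp only: exp_add exp_minus cis_conv_exp mult.commute)
    then show ?thesis unfolding r_def exp_of_real by simp
  qed

  define z where "z = Re (zeta (of_nat s))"
  have Z: "zeta (of_nat s) = of_real z"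
    unfolding z_def by (rule zeta_of_nat_real) (use assms in \<open>simp add: s_def\<close>)
  define l1 where "l1 = Re (\<Lambda> (of_real x))"
  define l2 where "l2 = Re (\<Lambda> ((of_real x)\<^sup>2))"
  define l4 where "l4 = Re (\<Lambda> ((of_real x) ^ 4))"
  define m where "m = Re (\<Lambda> (- of_real x))"
  have \<Lambda>_real: "\<Lambda> (of_real x) = of_real l1" "\<Lambda> ((of_real x)\<^sup>2) = of_real l2"
     "\<Lambda> ((of_real x) ^ 4) = of_real l4" "\<Lambda> (- of_real x) = of_real m"
    unfolding \<Lambda>_def l1_def l2_def l4_def m_def of_real_power[symmetric] of_real_minus[symmetric]
    by (rule lambert_series_of_real; use x in \<open>simp add: power_abs power_less_one_iff\<close>)+

  \<comment> \<open>Both the Hecke weight 2^(1-s) = E^2 and the modulus of \<alpha>^(-4k), which is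
    E, are powers of this number.\<close>
  define E where "E = 1 / (2 ^ (2 * k) :: real)"
  have E2: "2 / 2 ^ s = E\<^sup>2"
    by (simp add: E_def s_def power_divide flip: power_mult)
  define C where "C = cos (4 * real k * \<theta>)"
  have EC: "C / 2 ^ (2 * k) = E * C" by (simp add: E_def)
  have Re_inv: "Re (1 / \<alpha> ^ (4 * k)) = E * C"
    using Re_inverse_\<alpha>_power[OF \<alpha>_polar, of k] unfolding E_def C_def by simp
  have d: "1 - E * C > 0"
    using one_minus_cos_pos[OF assms(4), of "4 * real k * \<theta>"] EC unfolding C_def by linarith

  have dup: "\<Lambda> q + \<Lambda> (- q) = of_real (2 + E\<^sup>2) * \<Lambda> (q\<^sup>2) - of_real (E\<^sup>2) * \<Lambda> (q ^ 4)" if "norm q < 1" for q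
    using lambert_series_duplication[OF that, of s] unfolding \<Lambda>_def E2[symmetric] by simp
  \<comment> \<open>The Hecke relation at x trades the value at -x for the three series of the
    theorem.\<close>
  have "of_real (l1 + m) = complex_of_real ((2 + E\<^sup>2) * l2 - E\<^sup>2 * l4)"
    using dup[of "of_real x"] x by (simp add: \<Lambda>_real)
  then have m_eq: "m = (2 + E\<^sup>2) * l2 - E\<^sup>2 * l4 - l1"
    unfolding of_real_eq_iff by simp

  \<comment> \<open>As r and -r are conjugate, the left side of the Hecke relation at r is twice a
    real part; its right side involves r^2 = -x and r^4 = x^2.\<close>
  have "\<Lambda> r = cnj (\<Lambda> (- r))"
    using lambert_series_cnj[of "- r" s] norm_r unfolding cnj_r \<Lambda>_def by simp
  then have "2 * Re (\<Lambda> (- r)) = Re (\<Lambda> r + \<Lambda> (- r))" by simp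
  also have "\<dots> = (2 + E\<^sup>2) * m - E\<^sup>2 * l2"
    unfolding dup[OF norm_r] r2 r4 \<Lambda>_real by (simp flip: of_real_mult of_real_diff)
  finally have Re_\<Lambda>_r: "2 * Re (\<Lambda> (- r)) = (2 + E\<^sup>2) * m - E\<^sup>2 * l2" .

  define P where "P = (2 * pi) ^ s"
  define \<beta> where "\<beta> = (\<lambda>j. bernoulli_coeff j * bernoulli_coeff (2 * k + 1 - j))"
  have \<beta>: "bernoulli_coeff j * bernoulli_coeff (2 * k + 1 - j) = \<beta> j" for j
    by (simp add: \<beta>_def)
  define \<Sigma> where "\<Sigma> = (\<Sum>j=0..k. (- 1) ^ j * coeff_c \<theta> j k * \<beta> j)"
  have "\<Lambda> (- r) + of_real z / 2 = (of_real m + of_real z / 2) / \<alpha> ^ (4 * k) -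
      of_real (P / 2) * (\<Sum>j\<le>2 * k + 1. \<i> * (\<alpha> ^ (2 * j) / \<alpha>) / \<alpha> ^ (4 * k) * of_real (\<beta> j))"
  proof -
    have "Im \<alpha> > 0" by (simp add: \<alpha>_def)
    from lambert_series_inversion[OF this assms(4)] show ?thesis
      unfolding q_\<alpha> q_inv s_def[symmetric] \<Lambda> Z \<Lambda>_real P_def[symmetric] \<beta> .
  qed
  also have "(of_real m + of_real z / 2) / \<alpha> ^ (4 * k) = of_real (m + z / 2) * (1 / \<alpha> ^ (4 * k))"
    by simp
  \<comment> \<open>Real parts are taken because the Hecke relation at r determines only the real
    part of the value at -r.\<close>
  finally have "Re (\<Lambda> (- r)) + z / 2 = Re (of_real (m + z / 2) * (1 / \<alpha> ^ (4 * k)) -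
      of_real (P / 2) * (\<Sum>j\<le>2 * k + 1. \<i> * (\<alpha> ^ (2 * j) / \<alpha>) / \<alpha> ^ (4 * k) * of_real (\<beta> j)))"
    by (metis (no_types, lifting) Re_complex_of_real of_real_divide of_real_numeral plus_complex.sel(1))
  also have "\<dots> = (m + z / 2) * (E * C) - P / 2 * (\<Sum>j\<le>2 * k + 1. Re (\<i> * (\<alpha> ^ (2 * j) / \<alpha>) / \<alpha> ^ (4 * k)) * \<beta> j)"
    by (simp only: Re_inv minus_complex.sel times_complex.sel Re_complex_of_real Im_complex_of_real Re_sum mult_zero_left mult_zero_right diff_zero)
  also have "(\<Sum>j\<le>2 * k + 1. Re (\<i> * (\<alpha> ^ (2 * j) / \<alpha>) / \<alpha> ^ (4 * k)) * \<beta> j) = - (1 - E * C) * \<Sigma>"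
    using period_sum_coeff_c[OF assms(4), of \<theta> bernoulli_coeff] EC
    unfolding Re_period_term[OF \<alpha>_polar] \<beta> \<Sigma>_def C_def by simp
  \<comment> \<open>Doubling and inserting \<open>Re_\<Lambda>_r\<close> eliminates the value at -r;
    what remains is linear in z.\<close>
  finally have "(2 + E\<^sup>2) * m - E\<^sup>2 * l2 + z = 2 * ((m + z / 2) * (E * C)) + P * ((1 - E * C) * \<Sigma>)"
    using Re_\<Lambda>_r by (simp add: algebra_simps)
  then have "z * (1 - E * C) = P * ((1 - E * C) * \<Sigma>) - (2 + E\<^sup>2 - 2 * (E * C)) * m + E\<^sup>2 * l2"
    by (simp add: algebra_simps)
  \<comment> \<open>Inserting m makes the coefficient of l2 equal to E^2 - (2 + E^2)(2 + E^2 - 2EC),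
    which is the numerator of b.\<close>
  also have "\<dots> = (1 - E * C) * (P * \<Sigma>) + (2 + E\<^sup>2 - 2 * (E * C)) * l1
       - (4 + 3 * E\<^sup>2 + E ^ 4 - 4 * E * C - 2 * E ^ 3 * C) * l2 + E\<^sup>2 * (2 + E\<^sup>2 - 2 * (E * C)) * l4"
    unfolding m_eq by (simp add: algebra_simps power2_eq_square power3_eq_cube power4_eq_xxxx)
  finally have "z = P * \<Sigma> + (2 + E\<^sup>2 - 2 * (E * C)) / (1 - E * C) * l1
       - (4 + 3 * E\<^sup>2 + E ^ 4 - 4 * E * C - 2 * E ^ 3 * C) / (1 - E * C) * l2
       + E\<^sup>2 * ((2 + E\<^sup>2 - 2 * (E * C)) / (1 - E * C)) * l4"
    using d by (simp add: divide_simps mult.commute)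
  moreover have pow: "1 / 2 ^ (4 * k) = E\<^sup>2" "2 powr (- 4 * real k) = E\<^sup>2"
    using powr_realpow[of 2 "4 * k"] by (simp_all add: E_def power_divide powr_minus field_simps flip: power_mult)
  moreover have "coeff_a \<theta> k = (2 + E\<^sup>2 - 2 * (E * C)) / (1 - E * C)"
    using pow by (simp only: coeff_a_eq EC[unfolded C_def] C_def)
  moreover have "coeff_b \<theta> k = - ((4 + 3 * E\<^sup>2 + E ^ 4 - 4 * E * C - 2 * E ^ 3 * C) / (1 - E * C))"
    unfolding coeff_b_eq E_def C_def ..
  ultimately have "z = P * \<Sigma> + coeff_a \<theta> k * l1 + coeff_b \<theta> k * l2 + (2 powr (- 4 * real k) * coeff_a \<theta> k) * l4"
    by simp
  moreover have "\<Sigma> = (\<Sum>j=0..k. (-1) ^ j * coeff_c \<theta> j k * bernoulli (2 * j) * bernoulli (4 * k + 2 - 2 * j)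
                 / (fact (2 * j) * fact (4 * k + 2 - 2 * j)))"
    unfolding \<Sigma>_def \<beta>_def bernoulli_coeff_def
    by (intro sum.cong) (auto simp: diff_mult_distrib2)
  ultimately show ?thesis
    unfolding exponent x_powers x_def[symmetric] s_def[symmetric] Z \<Lambda> of_real_power \<Lambda>_real P_def[symmetric]
    by simp
qed

end
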